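(* Let $R$ be a principal ideal domain and let $I=gR\subsetneq R$ be a proper, non-prime ideal such that $Q:=R/I$ is finite. Write $g=u\cdot\prod_{i=1}^n p_i^{m_i}$ with $u$ a unit, $p_1,\dots,p_n$ pairwise non-associated prime elements and integers $m_1,\dots,m_n\ge 1$. Suppose $n\ge 2$. Then the zero divisor graph $\Gamma(Q)$ satisfies \[\mathrm{box}(\Gamma(Q))=\begin{cases} n & \text{if there is } i\in[n] \text{ with } m_i\ge 3,\\ n & \text{if } m_i=2 \text{ or } |R/p_iR|\ge 3 \text{ for every } i\in[n],\\ n-1 & \text{if } n\ge 3,\ m_i\in\{1,2\} \text{ for all } i\in[n], \text{ and there is } i\in[n] \text{ with } m_i=1 \text{ and } |R/p_iR|=2,\\ 1 & \text{if } n=2,\ m_1,m_2\in\{1,2\}, \text{ and there is exactly one } i\in\{1,2\} \text{ with } m_i=1 \text{ and } |R/p_iR|=2,\\ 0 & \text{if } n=2,\ m_1=m_2=1 \text{ and } |R/p_1R|=|R/p_2R|=2. \end{cases}\]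
   Context: $[n]=\{1,\dots,n\}$. Rings are commutative and non-zero with $1$. For a ring $Q$, $Z(Q)$ is the set of $r\in Q$ for which there is $s\in Q\setminus\{0\}$ with $rs=0$. The zero divisor graph $\Gamma(Q)$ has vertex set $Z(Q)\setminus\{0\}$; two distinct vertices $r,s$ are adjacent iff $rs=0$. The boxicity $\mathrm{box}(G)$ of a finite simple graph $G$ is the minimum integer $d\ge 0$ such that there exist $d$ interval graphs $I_1,\dots,I_d$ on the vertex set $V(G)$ with $E(G)=\bigcap_{j=1}^d E(I_j)$; the empty intersection ($d=0$) is the set of all pairs of vertices, so $\mathrm{box}(G)=0$ iff $G$ is complete. *)

theory Defs
  imports
    Complex_Main
    "HOL-Algebra.Ring_Divisibility"
    "Graph_Theory.Pair_Digraph"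
begin

text \<open>
  Finite simple graphs are represented by \<^locale>\<open>pair_graph\<close>: a finite vertex set
  \<^const>\<open>pverts\<close> and a symmetric irreflexive relation \<^const>\<open>parcs\<close> on it, in which an edge
  \<open>{u, v}\<close> appears as the two pairs \<open>(u, v)\<close> and \<open>(v, u)\<close>. Intersecting edge sets is thus
  intersecting the relations \<^const>\<open>parcs\<close>.
\<close>

subsection \<open>Zero divisor graphs\<close>

text \<open>In a non-zero ring, \<open>\<zero>\<close> itself belongs to \<open>zero_divisors\<close>.\<close>

definition zero_divisors :: "('a, 'b) ring_scheme \<Rightarrow> 'a set" where
  "zero_divisors Q =
     {r \<in> carrier Q. \<exists>s \<in> carrier Q - {\<zero>\<^bsub>Q\<^esub>}. r \<otimes>\<^bsub>Q\<^esub> s = \<zero>\<^bsub>Q\<^esub>}"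

definition zero_divisor_graph :: "('a, 'b) ring_scheme \<Rightarrow> 'a pair_pre_digraph" where
  "zero_divisor_graph Q =
     (let V = zero_divisors Q - {\<zero>\<^bsub>Q\<^esub>}
      in \<lparr>pverts = V,
          parcs = {(r, s). r \<in> V \<and> s \<in> V \<and> r \<noteq> s \<and> r \<otimes>\<^bsub>Q\<^esub> s = \<zero>\<^bsub>Q\<^esub>}\<rparr>)"

lemma zero_divisor_graph_pair_graph:
  assumes "cring Q" "finite (carrier Q)"
  shows "pair_graph (zero_divisor_graph Q)"
proof -
  interpret cring Q by fact
  have fin: "finite (zero_divisors Q)"
    using assms(2) by (simp add: zero_divisors_def)
  have "parcs (zero_divisor_graph Q) \<subseteq> zero_divisors Q \<times> zero_divisors Q"
    by (auto simp: zero_divisor_graph_def Let_def)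
  then have "finite (parcs (zero_divisor_graph Q))"
    using fin finite_subset by blast
  moreover have "sym (parcs (zero_divisor_graph Q))"
    by (auto simp: sym_def zero_divisor_graph_def zero_divisors_def Let_def m_comm)
  ultimately show ?thesis
    using fin by unfold_locales
      (auto simp: zero_divisor_graph_def Let_def Digraph.symmetric_def)
qed

subsection \<open>Interval graphs and boxicity\<close>

text \<open>
  For finite graphs, non-empty compact intervals represent the same graphs as arbitrary
  non-empty real intervals. The condition \<open>a v \<le> b v\<close> excludes empty intervals.
\<close>

definition interval_graph :: "'v pair_pre_digraph \<Rightarrow> bool" where
  "interval_graph G \<longleftrightarrow> pair_graph G \<and>
     (\<exists>a b :: 'v \<Rightarrow> real.
        (\<forall>v \<in> pverts G. a v \<le> b v) \<and>
        (\<forall>u \<in> pverts G. \<forall>v \<in> pverts G. u \<noteq> v \<longrightarrow>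
           ((u, v) \<in> parcs G \<longleftrightarrow> {a u..b u} \<inter> {a v..b v} \<noteq> {})))"

definition vertex_pairs :: "'v set \<Rightarrow> 'v rel" where
  "vertex_pairs V = {(u, v). u \<in> V \<and> v \<in> V \<and> u \<noteq> v}"

text \<open>
  Intersecting with \<^const>\<open>vertex_pairs\<close> only matters for \<open>d = 0\<close>: it makes the empty
  intersection the set of all pairs of distinct vertices.
\<close>

definition interval_representation ::
    "'v pair_pre_digraph \<Rightarrow> nat \<Rightarrow> (nat \<Rightarrow> 'v pair_pre_digraph) \<Rightarrow> bool" where
  "interval_representation G d I \<longleftrightarrow>
     (\<forall>j \<in> {1..d}. interval_graph (I j) \<and> pverts (I j) = pverts G) \<and>
     parcs G = vertex_pairs (pverts G) \<inter> (\<Inter>j \<in> {1..d}. parcs (I j))"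

definition boxicity :: "'v pair_pre_digraph \<Rightarrow> nat" where
  "boxicity G = (LEAST d. \<exists>I. interval_representation G d I)"

text \<open>The minimum is taken over a non-empty set.\<close>

lemma interval_representation_exists:
  assumes "pair_graph G"
  shows "\<exists>d I. interval_representation G d I"
proof -
  interpret pair_graph G by fact
  define V where "V = pverts G"
  define N where "N = vertex_pairs V - parcs G"
  have finV: "finite V"
    by (simp add: V_def pair_finite_verts)
  have fin2: "finite A" if "A \<subseteq> vertex_pairs V" for A
    by (rule finite_subset[of _ "V \<times> V"]) (use that finV in \<open>auto simp: vertex_pairs_def\<close>)
  define H where
    "H = (\<lambda>(x, y). \<lparr>pverts = V, parcs = vertex_pairs V - {(x, y), (y, x)}\<rparr>)"
  have H: "interval_graph (H (x, y))" if "x \<noteq> y" for x y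
  proof -
    have "finite (vertex_pairs V - {(x, y), (y, x)})"
      by (rule fin2) auto
    moreover have "sym (vertex_pairs V - {(x, y), (y, x)})"
      by (auto simp: sym_def vertex_pairs_def)
    ultimately have "pair_graph (H (x, y))"
      using finV by unfold_locales
        (auto simp: H_def vertex_pairs_def Digraph.symmetric_def)
    then show ?thesis
      unfolding interval_graph_def
      by (intro conjI exI[of _ "\<lambda>v. if v = y then 1 else 0"]
            exI[of _ "\<lambda>v. if v = x then 0 else 1"])
        (use that in \<open>auto simp: H_def vertex_pairs_def\<close>)
  qed
  have "finite N"
    by (rule fin2) (auto simp: N_def)
  then obtain e where e: "bij_betw e {1..card N} N"
    using ex_bij_betw_nat_finite_1 by blast
  have img: "e ` {1..card N} = N"
    using e by (simp add: bij_betw_def)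
  have symG: "(v, u) \<in> parcs G" if "(u, v) \<in> parcs G" for u v
    using that pair_sym_arcs by (auto simp: Digraph.symmetric_def sym_def)
  have subG: "parcs G \<subseteq> vertex_pairs V"
    using pair_no_loops in_arcsD1 in_arcsD2 by (fastforce simp: V_def vertex_pairs_def)
  have "(\<Inter>j \<in> {1..card N}. parcs (H (e j))) = (\<Inter>p \<in> e ` {1..card N}. parcs (H p))"
    by blast
  then have "(\<Inter>j \<in> {1..card N}. parcs (H (e j))) = (\<Inter>p \<in> N. parcs (H p))"
    unfolding img .
  moreover have "parcs G = vertex_pairs V \<inter> (\<Inter>p \<in> N. parcs (H p))"
    using subG symG by (fastforce simp: H_def N_def)
  moreover have "interval_graph (H p) \<and> pverts (H p) = V" if "p \<in> N" for p
    using that H by (cases p) (auto simp: N_def vertex_pairs_def H_def)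
  moreover have "e j \<in> N" if "j \<in> {1..card N}" for j
    using that img by blast
  ultimately have "interval_representation G (card N) (\<lambda>j. H (e j))"
    unfolding interval_representation_def V_def by metis
  then show ?thesis by blast
qed

lemma boxicity_eq_0_iff:
  assumes "pair_graph G"
  shows "boxicity G = 0 \<longleftrightarrow> parcs G = vertex_pairs (pverts G)"
proof
  assume "boxicity G = 0"
  then have "\<exists>I. interval_representation G 0 I"
    using LeastI_ex[OF interval_representation_exists[OF assms]]
    by (simp add: boxicity_def)
  then show "parcs G = vertex_pairs (pverts G)"
    by (auto simp: interval_representation_def)
next
  assume "parcs G = vertex_pairs (pverts G)"
  then have "interval_representation G 0 I" for I
    by (simp add: interval_representation_def)
  then show "boxicity G = 0"
    unfolding boxicity_def by (intro Least_eq_0) blast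
qed

end

theory Submission
  imports Defs
begin

text \<open>
  An element \<open>x\<close> of \<open>Q\<close> is described by its valuations \<open>v\<^sub>i x \<in> {0..m\<^sub>i}\<close> at the primes \<open>p\<^sub>i\<close>, and
  \<open>x y = 0\<close> iff \<open>v\<^sub>i x + v\<^sub>i y \<ge> m\<^sub>i\<close> for all \<open>i\<close>. So the zero divisor graph is an intersection of \<open>n\<close>
  threshold graphs, which are interval graphs. If \<open>m\<^sub>k = 1\<close> and \<open>|R/p\<^sub>kR| = 2\<close>, and all \<open>m\<^sub>i \<le> 2\<close>, the
  \<open>k\<close>-th of them can be dispensed with: only one element has \<open>v\<^sub>k = 0\<close> and full valuation elsewhere,
  so that any two distinct elements with \<open>v\<^sub>k = 0\<close> can be separated in some other coordinate.

  The lower bound \<open>n\<close> comes from \<open>n\<close> non-adjacent pairs any two of which induce a four-cycle, and so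
  are separated by different interval graphs. The lower bound \<open>n - 1\<close> uses the induced subgraph
  of elements \<open>e\<^sub>S\<close> with \<open>v\<^sub>i = 0\<close> for \<open>i \<in> S\<close> and full valuation elsewhere, where \<open>e\<^sub>S\<close> and \<open>e\<^sub>S\<^sub>'\<close>
  are adjacent iff \<open>S \<inter> S' = {}\<close>: an interval graph containing it separates at most
  \<open>max (n + 1) 5\<close> of the \<open>n (n - 1)\<close> pairs \<open>(e\<^bsub>{i}\<^esub>, e\<^bsub>{i, k}\<^esub>)\<close>.
\<close>

section \<open>Boxicity through interval families\<close>

text \<open>Non-empty compact intervals meet iff each begins no later than the other ends. Stated
  through these two inequalities, adjacency becomes linear arithmetic on endpoints.\<close>

definition overlap_graph :: "'v set \<Rightarrow> ('v \<Rightarrow> real) \<Rightarrow> ('v \<Rightarrow> real) \<Rightarrow> 'v pair_pre_digraph" where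
  "overlap_graph V a b =
     \<lparr>pverts = V, parcs = {(u, v) \<in> vertex_pairs V. a u \<le> b v \<and> a v \<le> b u}\<rparr>"

lemma interval_overlap_iff:
  fixes a b c d :: real
  assumes "a \<le> b" "c \<le> d"
  shows "{a..b} \<inter> {c..d} \<noteq> {} \<longleftrightarrow> a \<le> d \<and> c \<le> b"
  using assms by auto

lemma interval_graph_overlap_graph:
  assumes "finite V" "\<forall>v\<in>V. a v \<le> b v"
  shows "interval_graph (overlap_graph V a b)"
proof -
  have "finite {(u, v) \<in> vertex_pairs V. a u \<le> b v \<and> a v \<le> b u}"
    by (rule finite_subset[of _ "V \<times> V"]) (use assms(1) in \<open>auto simp: vertex_pairs_def\<close>)
  moreover have "sym {(u, v) \<in> vertex_pairs V. a u \<le> b v \<and> a v \<le> b u}"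
    by (auto simp: sym_def vertex_pairs_def)
  ultimately have "pair_graph (overlap_graph V a b)"
    using assms(1) by unfold_locales
      (auto simp: overlap_graph_def vertex_pairs_def Digraph.symmetric_def)
  then show ?thesis
    unfolding interval_graph_def
    by (intro conjI exI[of _ a] exI[of _ b])
      (use assms(2) interval_overlap_iff in \<open>auto simp: overlap_graph_def vertex_pairs_def\<close>)
qed

lemma pair_graph_parcs_subset:
  assumes "pair_graph G"
  shows "parcs G \<subseteq> vertex_pairs (pverts G)"
proof -
  interpret pair_graph G by fact
  show ?thesis
    using pair_no_loops in_arcsD1 in_arcsD2 by (fastforce simp: vertex_pairs_def)
qed

text \<open>The index set is arbitrary so that the primes themselves can number the interval graphs;
  a bijection with \<open>{1..card J}\<close> translates back.\<close>

lemma boxicity_le_card: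
  fixes a b :: "'i \<Rightarrow> 'v \<Rightarrow> real"
  assumes G: "pair_graph G" and J: "finite J"
    and le: "\<And>j v. j \<in> J \<Longrightarrow> v \<in> pverts G \<Longrightarrow> a j v \<le> b j v"
    and adj: "\<And>u v. u \<in> pverts G \<Longrightarrow> v \<in> pverts G \<Longrightarrow> u \<noteq> v \<Longrightarrow>
      (u, v) \<in> parcs G \<longleftrightarrow> (\<forall>j\<in>J. a j u \<le> b j v \<and> a j v \<le> b j u)"
  shows "boxicity G \<le> card J"
proof -
  interpret pair_graph G by fact
  obtain e where e: "bij_betw e {1..card J} J"
    using J ex_bij_betw_nat_finite_1 by blast
  have img: "e ` {1..card J} = J"
    using e by (simp add: bij_betw_def)
  define I where "I = (\<lambda>j. overlap_graph (pverts G) (a (e j)) (b (e j)))"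
  have mem: "(u, v) \<in> parcs G \<longleftrightarrow>
      (u, v) \<in> vertex_pairs (pverts G) \<inter> (\<Inter>j\<in>{1..card J}. parcs (I j))" for u v
  proof (cases "(u, v) \<in> vertex_pairs (pverts G)")
    case True
    then have "(u, v) \<in> parcs G \<longleftrightarrow> (\<forall>j\<in>J. a j u \<le> b j v \<and> a j v \<le> b j u)"
      using adj by (simp add: vertex_pairs_def)
    also have "\<dots> \<longleftrightarrow>
        (\<forall>j\<in>{1..card J}. a (e j) u \<le> b (e j) v \<and> a (e j) v \<le> b (e j) u)"
      by (subst img[symmetric]) simp
    finally have "(u, v) \<in> parcs G \<longleftrightarrow>
        (\<forall>j\<in>{1..card J}. a (e j) u \<le> b (e j) v \<and> a (e j) v \<le> b (e j) u)" .
    then show ?thesis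
      using True by (auto simp: I_def overlap_graph_def)
  next
    case False
    then show ?thesis
      using pair_graph_parcs_subset[OF G] by blast
  qed
  have "interval_graph (I j)" if "j \<in> {1..card J}" for j
  proof -
    have "e j \<in> J"
      using that img by blast
    then show ?thesis
      using le pair_finite_verts by (auto simp: I_def intro: interval_graph_overlap_graph)
  qed
  moreover have "pverts (I j) = pverts G" for j
    by (simp add: I_def overlap_graph_def)
  moreover have "parcs G = vertex_pairs (pverts G) \<inter> (\<Inter>j\<in>{1..card J}. parcs (I j))"
    using mem by (intro equalityI subsetI) (auto simp only: split_paired_all)
  ultimately have "interval_representation G (card J) I"
    by (simp add: interval_representation_def)
  then show ?thesis
    unfolding boxicity_def by (auto intro: Least_le)
qed

text \<open>The minimum is attained, so an optimal representation can be fixed by its endpoints.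
  Both lower bound arguments start here.\<close>

lemma boxicity_intervalsE:
  assumes G: "pair_graph G"
  obtains a b :: "nat \<Rightarrow> 'v \<Rightarrow> real" where
    "\<And>j v. j \<in> {1..boxicity G} \<Longrightarrow> v \<in> pverts G \<Longrightarrow> a j v \<le> b j v"
    "\<And>u v. u \<in> pverts G \<Longrightarrow> v \<in> pverts G \<Longrightarrow> u \<noteq> v \<Longrightarrow>
      (u, v) \<in> parcs G \<longleftrightarrow> (\<forall>j\<in>{1..boxicity G}. a j u \<le> b j v \<and> a j v \<le> b j u)"
proof -
  have "\<exists>I. interval_representation G (boxicity G) I"
    unfolding boxicity_def by (rule LeastI_ex[OF interval_representation_exists[OF G]])
  then obtain I where
    I: "\<And>j. j \<in> {1..boxicity G} \<Longrightarrow> interval_graph (I j) \<and> pverts (I j) = pverts G"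
    and arcs: "parcs G = vertex_pairs (pverts G) \<inter> (\<Inter>j\<in>{1..boxicity G}. parcs (I j))"
    unfolding interval_representation_def by blast
  have "\<forall>j\<in>{1..boxicity G}. \<exists>a b :: 'v \<Rightarrow> real. (\<forall>v\<in>pverts G. a v \<le> b v) \<and>
      (\<forall>u\<in>pverts G. \<forall>v\<in>pverts G. u \<noteq> v \<longrightarrow>
        ((u, v) \<in> parcs (I j) \<longleftrightarrow> {a u..b u} \<inter> {a v..b v} \<noteq> {}))"
    using I unfolding interval_graph_def by metis
  then obtain a b :: "nat \<Rightarrow> 'v \<Rightarrow> real" where
    ab: "\<forall>j\<in>{1..boxicity G}. (\<forall>v\<in>pverts G. a j v \<le> b j v) \<and>
      (\<forall>u\<in>pverts G. \<forall>v\<in>pverts G. u \<noteq> v \<longrightarrow>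
        ((u, v) \<in> parcs (I j) \<longleftrightarrow> {a j u..b j u} \<inter> {a j v..b j v} \<noteq> {}))"
    by (metis (no_types))
  show ?thesis
  proof (rule that[of a b])
    show le: "a j v \<le> b j v" if "j \<in> {1..boxicity G}" "v \<in> pverts G" for j v
      using ab that by blast
    fix u v
    assume uv: "u \<in> pverts G" "v \<in> pverts G" "u \<noteq> v"
    have "(u, v) \<in> parcs (I j) \<longleftrightarrow> a j u \<le> b j v \<and> a j v \<le> b j u"
      if "j \<in> {1..boxicity G}" for j
      using ab that uv interval_overlap_iff[OF le[OF that uv(1)] le[OF that uv(2)]] by blast
    then show "(u, v) \<in> parcs G \<longleftrightarrow>
        (\<forall>j\<in>{1..boxicity G}. a j u \<le> b j v \<and> a j v \<le> b j u)"
      using uv by (subst arcs) (auto simp: vertex_pairs_def)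
  qed
qed

text \<open>Two of the pairs cannot be separated by the same interval graph: they would form an
  induced four-cycle.\<close>

lemma boxicity_ge_card:
  fixes x y :: "'i \<Rightarrow> 'v"
  assumes G: "pair_graph G" and T: "finite T"
    and V: "\<And>t. t \<in> T \<Longrightarrow> x t \<in> pverts G" "\<And>t. t \<in> T \<Longrightarrow> y t \<in> pverts G"
    and ne: "\<And>t. t \<in> T \<Longrightarrow> x t \<noteq> y t" "\<And>t. t \<in> T \<Longrightarrow> (x t, y t) \<notin> parcs G"
    and cross: "\<And>s t. s \<in> T \<Longrightarrow> t \<in> T \<Longrightarrow> s \<noteq> t \<Longrightarrow>
      (x s, x t) \<in> parcs G \<and> (x s, y t) \<in> parcs G \<and> (y s, y t) \<in> parcs G"
  shows "card T \<le> boxicity G"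
proof -
  obtain a b :: "nat \<Rightarrow> 'v \<Rightarrow> real" where
    le: "\<And>j v. j \<in> {1..boxicity G} \<Longrightarrow> v \<in> pverts G \<Longrightarrow> a j v \<le> b j v"
    and adj: "\<And>u v. u \<in> pverts G \<Longrightarrow> v \<in> pverts G \<Longrightarrow> u \<noteq> v \<Longrightarrow>
      (u, v) \<in> parcs G \<longleftrightarrow> (\<forall>j\<in>{1..boxicity G}. a j u \<le> b j v \<and> a j v \<le> b j u)"
    using boxicity_intervalsE[OF G] by blast
  have "\<forall>t\<in>T. \<exists>j\<in>{1..boxicity G}. \<not> (a j (x t) \<le> b j (y t) \<and> a j (y t) \<le> b j (x t))"
    using adj V ne by metis
  \<comment> \<open>\<open>f t\<close> is an interval graph separating the pair of index
    \<open>t\<close>. The bound follows once \<open>f\<close> is injective.\<close>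
  then obtain f where f: "\<forall>t\<in>T. f t \<in> {1..boxicity G} \<and>
      \<not> (a (f t) (x t) \<le> b (f t) (y t) \<and> a (f t) (y t) \<le> b (f t) (x t))"
    by metis
  have ov: "a j u \<le> b j v \<and> a j v \<le> b j u" if "(u, v) \<in> parcs G" "j \<in> {1..boxicity G}" for u v j
    using adj that pair_graph_parcs_subset[OF G] by (fastforce simp: vertex_pairs_def)
  have "inj_on f T"
  proof (rule inj_onI, rule ccontr)
    fix s t
    assume st: "s \<in> T" "t \<in> T" "f s = f t" "s \<noteq> t"
    define j where "j = f t"
    have j: "j \<in> {1..boxicity G}" "f s = j" "f t = j"
      using f st by (auto simp: j_def)
    have "(x s, x t) \<in> parcs G" "(x s, y t) \<in> parcs G" "(y s, y t) \<in> parcs G"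
      "(x t, y s) \<in> parcs G"
      using cross st by metis+
    note this[THEN ov[OF _ j(1)]]
    moreover have "\<not> (a j (x s) \<le> b j (y s) \<and> a j (y s) \<le> b j (x s))"
      "\<not> (a j (x t) \<le> b j (y t) \<and> a j (y t) \<le> b j (x t))"
      using f st j by metis+
    moreover have "a j (x s) \<le> b j (x s)" "a j (x t) \<le> b j (x t)"
      "a j (y s) \<le> b j (y s)" "a j (y t) \<le> b j (y t)"
      using le j V st by auto
    \<comment> \<open>The intervals of \<open>x t\<close> and \<open>y t\<close> each meet both of
      the disjoint intervals of \<open>x s\<close> and \<open>y s\<close>, hence contain the gap
      between them, and so meet each other.\<close>
    ultimately show False by linarith
  qed
  then show ?thesis
    using f by (auto intro!: card_inj_on_le[of f T "{1..boxicity G}", simplified])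
qed

section \<open>Threshold graphs\<close>

text \<open>Such offsets separate vertices of equal weight without disturbing comparisons between
  different integer endpoints.\<close>

lemma inj_on_unit_interval:
  assumes "finite V"
  obtains e :: "'v \<Rightarrow> real" where "inj_on e V" "\<And>v. v \<in> V \<Longrightarrow> 0 \<le> e v \<and> e v < 1"
proof -
  obtain h where h: "bij_betw h V {0..<card V}"
    using assms ex_bij_betw_finite_nat by blast
  have lt: "h v < card V" if "v \<in> V" for v
    using bij_betwE[OF h] that by auto
  show ?thesis
  proof (rule that[of "\<lambda>v. real (h v) / real (card V)"])
    show "inj_on (\<lambda>v. real (h v) / real (card V)) V"
      using h lt by (fastforce simp: inj_on_def bij_betw_def)
    show "0 \<le> real (h v) / real (card V) \<and> real (h v) / real (card V) < 1" if "v \<in> V" for v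
      using lt[OF that] by simp
  qed
qed

text \<open>Vertices with \<open>M \<le> 2 * w v\<close> form a clique, as their intervals all start
  at \<open>0\<close>; the others are independent and become distinct points near
  \<open>M - w v\<close>. The offset \<open>e v / 2\<close> is below \<open>1 / 2\<close>, so such a
  point lies in a long interval ending at \<open>w u + 1 / 2\<close> exactly when
  \<open>M - w v \<le> w u\<close>.\<close>

lemma threshold_intervals:
  fixes w :: "'v \<Rightarrow> nat" and M :: nat
  assumes "finite V"
  shows "\<exists>a b :: 'v \<Rightarrow> real. (\<forall>v\<in>V. a v \<le> b v) \<and>
    (\<forall>u\<in>V. \<forall>v\<in>V. u \<noteq> v \<longrightarrow> (a u \<le> b v \<and> a v \<le> b u \<longleftrightarrow> M \<le> w u + w v))"
proof -
  obtain e :: "'v \<Rightarrow> real" where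
    inj: "inj_on e V" and e: "\<And>v. v \<in> V \<Longrightarrow> 0 \<le> e v \<and> e v < 1"
    using inj_on_unit_interval[OF assms] by blast
  define a :: "'v \<Rightarrow> real" where
    "a v = (if M \<le> 2 * w v then 0 else real M - real (w v) + e v / 2)" for v
  define b :: "'v \<Rightarrow> real" where
    "b v = (if M \<le> 2 * w v then real (w v) + 1 / 2 else a v)" for v
  have le: "a v \<le> b v" for v
    by (auto simp: a_def b_def)
  have "a u \<le> b v \<and> a v \<le> b u \<longleftrightarrow> M \<le> w u + w v" if uv: "u \<in> V" "v \<in> V" "u \<noteq> v" for u v
  proof -
    consider "M \<le> 2 * w u" "M \<le> 2 * w v" | "M \<le> 2 * w u" "\<not> M \<le> 2 * w v"
      | "\<not> M \<le> 2 * w u" "M \<le> 2 * w v" | "\<not> M \<le> 2 * w u" "\<not> M \<le> 2 * w v"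
      by blast
    then show ?thesis
    proof cases
      case 1
      then show ?thesis by (auto simp: a_def b_def)
    next
      case 2
      then show ?thesis using e[OF uv(2)] by (auto simp: a_def b_def)
    next
      case 3
      then show ?thesis using e[OF uv(1)] by (auto simp: a_def b_def)
    next
      case 4
      have "e u \<noteq> e v"
        using inj uv by (auto simp: inj_on_def)
      then have "a u \<noteq> a v"
        using 4 e[OF uv(1)] e[OF uv(2)] by (cases "w u" "w v" rule: linorder_cases) (auto simp: a_def)
      then show ?thesis using 4 by (auto simp: b_def)
    qed
  qed
  then show ?thesis using le by blast
qed

text \<open>The vertices of the set \<open>{v. z v}\<close> are moved apart, except for those of full weight \<open>M\<close>.
  The layout on the real line, with \<open>e\<close> an injection into \<open>[0, 1)\<close>:
  weight \<open>0\<close> off \<open>z\<close> is \<open>{e v}\<close>, weight \<open>1 < M\<close> off \<open>z\<close> is \<open>[2, 4]\<close>, weight \<open>M\<close> off \<open>z\<close> is \<open>[0, 6]\<close>;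
  weight \<open>0\<close> in \<open>z\<close> is \<open>{5 + e v}\<close>, weight \<open>1 < M\<close> in \<open>z\<close> is \<open>{3 + e v}\<close>, weight \<open>M\<close> in \<open>z\<close> is
  \<open>[0, 2]\<close>.\<close>

lemma split_threshold_intervals:
  fixes w :: "'v \<Rightarrow> nat" and M :: nat and z :: "'v \<Rightarrow> bool"
  assumes fin: "finite V" and M: "M \<in> {1, 2}" and w: "\<And>v. v \<in> V \<Longrightarrow> w v \<le> M"
  shows "\<exists>a b :: 'v \<Rightarrow> real. (\<forall>v\<in>V. a v \<le> b v) \<and>
    (\<forall>u\<in>V. \<forall>v\<in>V. u \<noteq> v \<longrightarrow> (a u \<le> b v \<and> a v \<le> b u \<longleftrightarrow>
      M \<le> w u + w v \<and> (z u \<and> z v \<longrightarrow> w u = M \<and> w v = M)))"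
proof -
  obtain e :: "'v \<Rightarrow> real" where
    inj: "inj_on e V" and e: "\<And>v. v \<in> V \<Longrightarrow> 0 \<le> e v \<and> e v < 1"
    using inj_on_unit_interval[OF fin] by blast
  define a :: "'v \<Rightarrow> real" where
    "a v = (if w v = M then 0 else if w v = 0 then if z v then 5 + e v else e v
            else if z v then 3 + e v else 2)" for v
  define b :: "'v \<Rightarrow> real" where
    "b v = (if w v = M then if z v then 2 else 6 else if w v = 0 then a v
            else if z v then a v else 4)" for v
  have le: "a v \<le> b v" for v
    by (auto simp: a_def b_def)
  have "a u \<le> b v \<and> a v \<le> b u \<longleftrightarrow> M \<le> w u + w v \<and> (z u \<and> z v \<longrightarrow> w u = M \<and> w v = M)"
    if uv: "u \<in> V" "v \<in> V" "u \<noteq> v" for u v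
  proof -
    have ne: "e u \<noteq> e v"
      using inj uv by (auto simp: inj_on_def)
    note eu = e[OF uv(1)] and ev = e[OF uv(2)]
    have cu: "w u = M \<or> w u \<noteq> M \<and> w u = 0 \<or> w u \<noteq> M \<and> w u = 1 \<and> M = 2"
      using M w[OF uv(1)] by auto
    have cv: "w v = M \<or> w v \<noteq> M \<and> w v = 0 \<or> w v \<noteq> M \<and> w v = 1 \<and> M = 2"
      using M w[OF uv(2)] by auto
    show ?thesis
      using cu
    proof (elim disjE)
      assume "w u = M"
      then show ?thesis using cv eu ev M
        by (elim disjE) (auto simp: a_def b_def)
    next
      assume "w u \<noteq> M \<and> w u = 0"
      then show ?thesis using cv eu ev ne M
        by (elim disjE) (auto simp: a_def b_def)
    next
      assume "w u \<noteq> M \<and> w u = 1 \<and> M = 2"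
      then show ?thesis using cv eu ev ne M
        by (elim disjE) (auto simp: a_def b_def)
    qed
  qed
  then show ?thesis using le by blast
qed

section \<open>Disjointness graphs of proper subsets\<close>

text \<open>The case \<open>i = k\<close> is included, so that singletons are covered as
  well.\<close>

lemma pair_psubset:
  assumes "card T \<ge> 3" "i \<in> T" "k \<in> T"
  shows "{i, k} \<subset> T"
proof -
  have "card {i, k} \<le> 2" by (simp add: card_insert_if)
  then have "T \<noteq> {i, k}" using assms(1) by auto
  then show ?thesis using assms by auto
qed

text \<open>Reflecting the line turns the statement about left neighbours into one about right
  neighbours.\<close>

lemma left_missed_arcs:
  fixes lo hi :: "'i set \<Rightarrow> real"
  assumes T: "finite T" "card T \<ge> 3"
    and disj: "\<And>S S'. S \<in> F \<Longrightarrow> S' \<in> F \<Longrightarrow> S \<inter> S' = {} \<Longrightarrow> lo S \<le> hi S'"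
    and F: "F = {S. S \<noteq> {} \<and> S \<subset> T}"
  shows "\<exists>s\<in>T. \<exists>q. {(i, k). i \<in> T \<and> k \<in> T \<and> i \<noteq> k \<and> hi {i, k} < lo {i}} \<subseteq>
    insert (q, s) (Pair s ` {k \<in> T - {s}. hi {s, k} < lo {s}})"
proof -
  have mem: "{i} \<in> F" "{i, k} \<in> F" if "i \<in> T" "k \<in> T" for i k
    using pair_psubset[OF T(2), of i i] pair_psubset[OF T(2), of i k] that by (auto simp: F)
  have "T \<noteq> {}" using T by auto
  then have "Max ((\<lambda>i. lo {i}) ` T) \<in> (\<lambda>i. lo {i}) ` T"
    using T(1) by (intro Max_in) auto
  then obtain s where "s \<in> T" "lo {s} = Max ((\<lambda>i. lo {i}) ` T)"
    by auto
  \<comment> \<open>\<open>s\<close> is the index whose singleton has the rightmost left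
    endpoint.\<close>
  then have s: "s \<in> T" "\<And>i. i \<in> T \<Longrightarrow> lo {i} \<le> lo {s}"
    using T(1) by auto
  \<comment> \<open>Otherwise \<open>{s}\<close> and \<open>{i, k}\<close> are disjoint sets, whence
    \<open>lo {s} \<le> hi {i, k} < lo {i}\<close>, against the choice of \<open>s\<close>.\<close>
  have to_s: "k = s" if "i \<in> T" "k \<in> T" "hi {i, k} < lo {i}" "i \<noteq> s" for i k
  proof (rule ccontr)
    assume "k \<noteq> s"
    then have "lo {s} \<le> hi {i, k}"
      using that s by (intro disj mem) auto
    then show False using s(2)[OF that(1)] that(3) by linarith
  qed
  \<comment> \<open>For \<open>i \<noteq> j\<close> the disjoint sets \<open>{j}\<close>,
    \<open>{i, s}\<close> and \<open>{i}\<close>, \<open>{j, s}\<close> give the cycle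
    \<open>lo {j} \<le> hi {i, s} < lo {i} \<le> hi {j, s} < lo {j}\<close>.\<close>
  have uniq: "i = j" if "i \<in> T" "hi {i, s} < lo {i}" "i \<noteq> s" "j \<in> T" "hi {j, s} < lo {j}" "j \<noteq> s"
    for i j
  proof (rule ccontr)
    assume "i \<noteq> j"
    then have "lo {j} \<le> hi {i, s}" "lo {i} \<le> hi {j, s}"
      using that s by (auto intro!: disj mem)
    then show False using that by linarith
  qed
  \<comment> \<open>If no such index exists, \<open>q\<close> is arbitrary, which only enlarges the
    covering set.\<close>
  define q where "q = (SOME i. i \<in> T \<and> hi {i, s} < lo {i} \<and> i \<noteq> s)"
  have "q = i" if "i \<in> T" "hi {i, s} < lo {i}" "i \<noteq> s" for i
    using someI[of "\<lambda>i. i \<in> T \<and> hi {i, s} < lo {i} \<and> i \<noteq> s" i] that uniq by (auto simp: q_def)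
  then have "{(i, k). i \<in> T \<and> k \<in> T \<and> i \<noteq> k \<and> hi {i, k} < lo {i}} \<subseteq>
      insert (q, s) (Pair s ` {k \<in> T - {s}. hi {s, k} < lo {s}})"
    using to_s by fastforce
  then show ?thesis using s(1) by blast
qed

text \<open>If \<open>t \<in> K\<close>, then \<open>s \<notin> L\<close>, and every
  \<open>k \<in> K\<close> other than \<open>t\<close> equals every \<open>l \<in> L\<close>. So
  either \<open>K = {t}\<close> and \<open>L\<close> avoids \<open>s\<close> and \<open>t\<close>,
  or \<open>L\<close> is a singleton and \<open>K\<close> has at most two elements. The case
  \<open>s \<in> L\<close> is symmetric. If neither holds, two of the sets can only meet in
  \<open>k = l\<close>.\<close>

lemma card_crossing_le:
  assumes T: "finite T" and st: "s \<in> T" "t \<in> T" "s \<noteq> t"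
    and K: "K \<subseteq> T - {s}" and L: "L \<subseteq> T - {t}"
    and cross: "\<And>k l. k \<in> K \<Longrightarrow> l \<in> L \<Longrightarrow> {s, k} \<inter> {t, l} \<noteq> {} \<and> {s, k} \<noteq> {t, l}"
  shows "card K + card L \<le> max (card T - 1) 3"
proof -
  have fin: "finite K" "finite L"
    using T K L finite_subset by blast+
  have two: "card T - 2 + 1 = card T - 1"
    using card_mono[of T "{s, t}"] T st by auto
  have cK: "card K \<le> card T - 1" and cL: "card L \<le> card T - 1"
    using card_mono[OF _ K] card_mono[OF _ L] T st by auto
  \<comment> \<open>Stated for renamed sets, so that it serves \<open>t \<in> K\<close> and, with
    the roles exchanged, \<open>s \<in> L\<close>.\<close>
  have aux: "card K' + card L' \<le> max (card T - 1) 3"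
    if "s' \<in> T" "t' \<in> T" "s' \<noteq> t'" "finite K'" "L' \<subseteq> T - {t'}" "t' \<in> K'" "L' \<noteq> {}"
      and c: "\<And>k l. k \<in> K' \<Longrightarrow> l \<in> L' \<Longrightarrow> {s', k} \<inter> {t', l} \<noteq> {} \<and> {s', k} \<noteq> {t', l}"
      and K': "K' \<subseteq> T - {s'}"
    for s' t' K' L'
  proof -
    have s'L: "s' \<notin> L'"
      using c[OF \<open>t' \<in> K'\<close>] by blast
    show ?thesis
    proof (cases "K' = {t'}")
      case True
      have "L' \<subseteq> T - {s', t'}"
        using that s'L by auto
      then have "card L' \<le> card T - 2"
        using card_mono[of "T - {s', t'}" L'] T that by (simp add: card_Diff_subset)
      then show ?thesis using True two by auto
    next
      case False
      then obtain k where k: "k \<in> K'" "k \<noteq> t'" using \<open>t' \<in> K'\<close> by blast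
      obtain l where l: "l \<in> L'" using \<open>L' \<noteq> {}\<close> by blast
      have "k' = l'" if "k' \<in> K'" "k' \<noteq> t'" "l' \<in> L'" for k' l'
        using c[OF that(1,3)] that s'L K' \<open>s' \<noteq> t'\<close> by auto
      then have "L' \<subseteq> {k}" "K' \<subseteq> {t', l}"
        using k l by auto
      then have "card L' \<le> card {k}" "card K' \<le> card {t', l}"
        using card_mono[of "{k}" L'] card_mono[of "{t', l}" K'] by auto
      then show ?thesis by (simp add: card_insert_if split: if_splits)
    qed
  qed
  show ?thesis
  proof (cases "K = {} \<or> L = {}")
    case True
    then show ?thesis using cK cL by auto
  next
    case False
    show ?thesis
    proof (cases "t \<in> K \<or> s \<in> L")
      case True
      then show ?thesis
      proof
        assume "t \<in> K"
        then show ?thesis using aux[of s t K L] st fin K L False cross by blast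
      next
        assume "s \<in> L"
        moreover have "{t, l} \<inter> {s, k} \<noteq> {} \<and> {t, l} \<noteq> {s, k}" if "l \<in> L" "k \<in> K" for k l
          using cross[OF that(2,1)] by (metis inf_commute)
        ultimately have "card L + card K \<le> max (card T - 1) 3"
          using st fin K L False by (intro aux[of t s L K]) auto
        then show ?thesis by simp
      qed
    next
      case ts: False
      obtain k l where kl: "k \<in> K" "l \<in> L" using False by blast
      have "k' = l'" if "k' \<in> K" "l' \<in> L" for k' l'
        using cross[OF that] that ts st by auto
      then have "K \<subseteq> {l}" "L \<subseteq> {k}" using kl by blast+
      then have "card K \<le> card {l}" "card L \<le> card {k}"
        using card_mono[of "{l}" K] card_mono[of "{k}" L] by auto
      then show ?thesis by simp
    qed
  qed
qed

text \<open>On either side the missed pairs form a star, centred at \<open>s\<close> or at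
  \<open>t\<close>, plus at most one further pair. For \<open>s = t\<close> the two stars together
  have at most \<open>card T - 1\<close> members; for \<open>s \<noteq> t\<close> they restrict each
  other by \<open>card_crossing_le\<close>. The further pairs add \<open>2\<close>.\<close>

lemma missed_arcs_card_le:
  fixes lo hi :: "'i set \<Rightarrow> real"
  assumes T: "finite T" "card T \<ge> 3"
    and F: "F = {S. S \<noteq> {} \<and> S \<subset> T}"
    and le: "\<And>S. S \<in> F \<Longrightarrow> lo S \<le> hi S"
    and disj: "\<And>S S'. S \<in> F \<Longrightarrow> S' \<in> F \<Longrightarrow> S \<inter> S' = {} \<Longrightarrow> lo S \<le> hi S'"
  shows "card {(i, k). i \<in> T \<and> k \<in> T \<and> i \<noteq> k \<and> (hi {i, k} < lo {i} \<or> hi {i} < lo {i, k})}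
    \<le> max (card T + 1) 5" (is "card ?A \<le> _")
proof -
  have mem: "{i} \<in> F" "{i, k} \<in> F" if "i \<in> T" "k \<in> T" for i k
    using pair_psubset[OF T(2), of i i] pair_psubset[OF T(2), of i k] that by (auto simp: F)
  have "\<exists>s\<in>T. \<exists>q. {(i, k). i \<in> T \<and> k \<in> T \<and> i \<noteq> k \<and> hi {i, k} < lo {i}} \<subseteq>
      insert (q, s) (Pair s ` {k \<in> T - {s}. hi {s, k} < lo {s}})"
    by (rule left_missed_arcs[OF T _ F]) (rule disj)
  then obtain s q where s: "s \<in> T" and
    left: "{(i, k). i \<in> T \<and> k \<in> T \<and> i \<noteq> k \<and> hi {i, k} < lo {i}} \<subseteq>
      insert (q, s) (Pair s ` {k \<in> T - {s}. hi {s, k} < lo {s}})"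
    by (elim bexE exE)
  have "\<exists>s\<in>T. \<exists>q. {(i, k). i \<in> T \<and> k \<in> T \<and> i \<noteq> k \<and> - lo {i, k} < - hi {i}} \<subseteq>
      insert (q, s) (Pair s ` {k \<in> T - {s}. - lo {s, k} < - hi {s}})"
  proof (rule left_missed_arcs[OF T _ F])
    show "- hi S \<le> - lo S'" if "S \<in> F" "S' \<in> F" "S \<inter> S' = {}" for S S'
      using disj[of S' S] that by (simp add: inf_commute)
  qed
  then obtain t r where t: "t \<in> T" and
    right: "{(i, k). i \<in> T \<and> k \<in> T \<and> i \<noteq> k \<and> - lo {i, k} < - hi {i}} \<subseteq>
      insert (r, t) (Pair t ` {k \<in> T - {t}. - lo {t, k} < - hi {t}})"
    by (elim bexE exE)
  define K where "K = {k \<in> T - {s}. hi {s, k} < lo {s}}"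
  define L where "L = {k \<in> T - {t}. hi {t} < lo {t, k}}"
  have fin: "finite K" "finite L"
    using T by (auto simp: K_def L_def)
  define A1 where "A1 = {(i, k). i \<in> T \<and> k \<in> T \<and> i \<noteq> k \<and> hi {i, k} < lo {i}}"
  define A2 where "A2 = {(i, k). i \<in> T \<and> k \<in> T \<and> i \<noteq> k \<and> hi {i} < lo {i, k}}"
  have "A1 \<subseteq> insert (q, s) (Pair s ` K)"
    unfolding A1_def K_def by (rule left)
  moreover have "A2 \<subseteq> insert (r, t) (Pair t ` L)"
    using right unfolding A2_def L_def neg_less_iff_less .
  moreover have "?A = A1 \<union> A2"
    unfolding A1_def A2_def by auto
  ultimately have sub: "?A \<subseteq> {(q, s), (r, t)} \<union> (Pair s ` K \<union> Pair t ` L)"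
    by auto
  have "card {(q, s), (r, t)} \<le> 2"
    by (simp add: card_insert_if)
  moreover have "card ?A \<le> card ({(q, s), (r, t)} \<union> (Pair s ` K \<union> Pair t ` L))"
    using fin by (intro card_mono sub) auto
  moreover have "\<dots> \<le> card {(q, s), (r, t)} + card (Pair s ` K \<union> Pair t ` L)"
    by (rule card_Un_le)
  ultimately have A: "card ?A \<le> 2 + card (Pair s ` K \<union> Pair t ` L)"
    by linarith
  show ?thesis
  proof (cases "s = t")
    case True
    have "card (Pair s ` K \<union> Pair t ` L) = card (K \<union> L)"
      using True by (simp add: image_Un[symmetric] card_image inj_on_def)
    also have "\<dots> \<le> card (T - {s})"
      using T True by (intro card_mono) (auto simp: K_def L_def)
    also have "\<dots> = card T - 1"
      using s T by simp
    finally show ?thesis using A T by simp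
  next
    case False
    have "card (Pair s ` K \<union> Pair t ` L) \<le> card K + card L"
      using card_Un_le[of "Pair s ` K" "Pair t ` L"] card_image_le[OF fin(1), of "Pair s"]
        card_image_le[OF fin(2), of "Pair t"] by linarith
    also have "\<dots> \<le> max (card T - 1) 3"
    proof (rule card_crossing_le[OF T(1) s t False])
      fix k l
      assume k: "k \<in> K" and l: "l \<in> L"
      \<comment> \<open>This yields \<open>hi {s, k} < lo {s} \<le> hi {t} < lo {t, l}\<close>.
        Disjoint intervals belong to sets that intersect, and to different sets because no interval
        is empty.\<close>
      have "lo {s} \<le> hi {t}"
        using s t False by (intro disj mem) auto
      then have lt: "hi {s, k} < lo {t, l}"
        using k l by (auto simp: K_def L_def)
      have "{s, k} \<in> F" "{t, l} \<in> F"
        using mem k l s t by (auto simp: K_def L_def)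
      then have "{t, l} \<inter> {s, k} \<noteq> {}" "{t, l} \<noteq> {s, k}"
        using lt le[of "{t, l}"] disj[of "{t, l}" "{s, k}"] by force+
      then show "{s, k} \<inter> {t, l} \<noteq> {} \<and> {s, k} \<noteq> {t, l}"
        by blast
    qed (auto simp: K_def L_def)
    finally show ?thesis using A T by simp
  qed
qed

text \<open>Every pair \<open>({i}, {i, k})\<close> has to be separated by one of the interval graphs, and each of
  them separates only few of these pairs.\<close>

lemma boxicity_ge_disjointness:
  fixes e :: "'i set \<Rightarrow> 'v"
  assumes G: "pair_graph G" and T: "finite T" "card T \<ge> 3"
    and F: "F = {S. S \<noteq> {} \<and> S \<subset> T}"
    and e: "\<And>S. S \<in> F \<Longrightarrow> e S \<in> pverts G" "inj_on e F"
    and eadj: "\<And>S S'. S \<in> F \<Longrightarrow> S' \<in> F \<Longrightarrow> S \<noteq> S' \<Longrightarrow>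
      (e S, e S') \<in> parcs G \<longleftrightarrow> S \<inter> S' = {}"
  shows "card T - 1 \<le> boxicity G"
proof -
  obtain a b :: "nat \<Rightarrow> 'v \<Rightarrow> real" where
    le: "\<And>j v. j \<in> {1..boxicity G} \<Longrightarrow> v \<in> pverts G \<Longrightarrow> a j v \<le> b j v"
    and adj: "\<And>u v. u \<in> pverts G \<Longrightarrow> v \<in> pverts G \<Longrightarrow> u \<noteq> v \<Longrightarrow>
      (u, v) \<in> parcs G \<longleftrightarrow> (\<forall>j\<in>{1..boxicity G}. a j u \<le> b j v \<and> a j v \<le> b j u)"
    using boxicity_intervalsE[OF G] by blast
  define d where "d = boxicity G"
  define n where "n = card T"
  have mem: "{i} \<in> F" "{i, k} \<in> F" if "i \<in> T" "k \<in> T" for i k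
    using pair_psubset[OF T(2), of i i] pair_psubset[OF T(2), of i k] that by (auto simp: F)
  define A where "A j = {(i, k). i \<in> T \<and> k \<in> T \<and> i \<noteq> k \<and>
    (b j (e {i, k}) < a j (e {i}) \<or> b j (e {i}) < a j (e {i, k}))}" for j
  have cA: "card (A j) \<le> max (n + 1) 5" if "j \<in> {1..d}" for j
    unfolding A_def n_def
  proof (rule missed_arcs_card_le[OF T F, of "\<lambda>S. a j (e S)" "\<lambda>S. b j (e S)"])
    show "a j (e S) \<le> b j (e S)" if "S \<in> F" for S
      using le e(1) that \<open>j \<in> {1..d}\<close> by (simp add: d_def)
    show "a j (e S) \<le> b j (e S')" if "S \<in> F" "S' \<in> F" "S \<inter> S' = {}" for S S'
    proof -
      have ne: "S \<noteq> S'" using that F by auto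
      then have "e S \<noteq> e S'" using e(2) that by (auto simp: inj_on_def)
      then show ?thesis
        using adj[of "e S" "e S'"] eadj[OF that(1,2) ne] that e(1) \<open>j \<in> {1..d}\<close>
        by (auto simp: d_def)
    qed
  qed
  \<comment> \<open>An ordered pair \<open>(i, k)\<close> stands for the non-edge between
    \<open>e {i}\<close> and \<open>e {i, k}\<close>; there are \<open>n * (n - 1)\<close> of
    them.\<close>
  have cover: "(SIGMA i:T. T - {i}) \<subseteq> (\<Union>j\<in>{1..d}. A j)"
  proof (rule subrelI)
    fix i k
    assume "(i, k) \<in> (SIGMA i:T. T - {i})"
    then have ik: "i \<in> T" "k \<in> T" "k \<noteq> i" by auto
    have "{i} \<noteq> {i, k}" using ik by auto
    moreover from this have "e {i} \<noteq> e {i, k}"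
      using inj_onD[OF e(2), of "{i}" "{i, k}"] mem ik by blast
    ultimately have "\<not> (\<forall>j\<in>{1..d}. a j (e {i}) \<le> b j (e {i, k}) \<and> a j (e {i, k}) \<le> b j (e {i}))"
      using adj[of "e {i}" "e {i, k}"] eadj[of "{i}" "{i, k}"] mem ik e(1) by (simp add: d_def)
    then show "(i, k) \<in> (\<Union>j\<in>{1..d}. A j)"
      using ik by (auto simp: A_def not_le)
  qed
  have finA: "finite (A j)" for j
    by (rule finite_subset[of _ "T \<times> T"]) (use T in \<open>auto simp: A_def\<close>)
  have "n * (n - 1) = card (SIGMA i:T. T - {i})"
    using T by (simp add: n_def)
  also have "\<dots> \<le> card (\<Union>j\<in>{1..d}. A j)"
    using cover finA by (intro card_mono) auto
  also have "\<dots> \<le> (\<Sum>j\<in>{1..d}. card (A j))"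
    by (intro card_UN_le) auto
  also have "\<dots> \<le> (\<Sum>j\<in>{1..d}. max (n + 1) 5)"
    by (intro sum_mono cA)
  finally have count: "n * (n - 1) \<le> d * max (n + 1) 5"
    by simp
  have n: "n \<ge> 3" using T by (simp add: n_def)
  have "n - 1 \<le> d"
  proof (rule ccontr)
    assume "\<not> n - 1 \<le> d"
    then have d: "d \<le> n - 2" by simp
    show False
    \<comment> \<open>For \<open>n = 3\<close> one graph would have to miss \<open>6\<close> pairs
      but misses at most \<open>5\<close>. For \<open>n \<ge> 4\<close> the maximum is
      \<open>n + 1\<close>, and \<open>(n - 2) * (n + 1)\<close> falls short of
      \<open>n * (n - 1)\<close> by \<open>2\<close>.\<close>
    proof (cases "n = 3")
      case True
      then show False using count d by simp
    next
      case False
      define h where "h = n - 2"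
      have h: "n = h + 2" "h \<ge> 2" using n False by (auto simp: h_def)
      have "n * (n - 1) \<le> d * (n + 1)" using count h by (simp add: max_def split: if_splits)
      also have "\<dots> \<le> h * (n + 1)" unfolding h_def by (rule mult_le_mono1[OF d])
      finally show False using h by (simp add: algebra_simps)
    qed
  qed
  then show ?thesis by (simp add: n_def d_def)
qed

section \<open>Zero divisor graphs of rings with capped valuations\<close>

text \<open>The predicate \<open>two\<close> stands for \<open>\<bar>R/p\<^sub>iR\<bar> = 2\<close>. The last two assumptions say when an
  element of the quotient that is divisible by every \<open>p\<^sub>j\<^bsup>m\<^sub>j\<^esup>\<close> with \<open>j \<noteq> i\<close> is determined by its
  valuation at \<open>i\<close>.\<close>

locale capped_valuation_ring = cring Q for Q (structure) +
  fixes T :: "'i set" and m :: "'i \<Rightarrow> nat" and val :: "'a \<Rightarrow> 'i \<Rightarrow> nat" and two :: "'i \<Rightarrow> bool"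
  assumes finite_carrier: "finite (carrier Q)"
    and finite_T: "finite T"
    and card_T: "card T \<ge> 2"
    and m_pos: "i \<in> T \<Longrightarrow> m i \<ge> 1"
    and val_le: "x \<in> carrier Q \<Longrightarrow> i \<in> T \<Longrightarrow> val x i \<le> m i"
    and mult_eq_zero_iff: "x \<in> carrier Q \<Longrightarrow> y \<in> carrier Q \<Longrightarrow>
      x \<otimes> y = \<zero> \<longleftrightarrow> (\<forall>i\<in>T. m i \<le> val x i + val y i)"
    and ex_val: "(\<And>i. i \<in> T \<Longrightarrow> w i \<le> m i) \<Longrightarrow> \<exists>x\<in>carrier Q. \<forall>i\<in>T. val x i = w i"
    and ex_two: "i \<in> T \<Longrightarrow> a < m i \<Longrightarrow> Suc a < m i \<or> \<not> two i \<Longrightarrow>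
      \<exists>x\<in>carrier Q. \<exists>y\<in>carrier Q. x \<noteq> y \<and>
        (\<forall>j\<in>T. val x j = (if j = i then a else m j) \<and> val y j = (if j = i then a else m j))"
    and val_unique: "i \<in> T \<Longrightarrow> m i = 1 \<Longrightarrow> two i \<Longrightarrow> x \<in> carrier Q \<Longrightarrow> y \<in> carrier Q \<Longrightarrow>
      \<forall>j\<in>T. val x j = (if j = i then 0 else m j) \<Longrightarrow>
      \<forall>j\<in>T. val y j = (if j = i then 0 else m j) \<Longrightarrow> x = y"
begin

section \<open>Vertices and edges in terms of valuations\<close>

lemma ex_other:
  assumes "i \<in> T"
  obtains j where "j \<in> T" "j \<noteq> i"
proof -
  have "\<not> T \<subseteq> {i}"
    using card_mono[of "{i}" T] card_T by auto
  then show ?thesis using that by blast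
qed

text \<open>Valuations are tied to the ring only through products, so \<open>x\<close> is tested
  against an element of valuation \<open>0\<close> everywhere and against the unit element.\<close>

lemma zero_iff:
  assumes x: "x \<in> carrier Q"
  shows "x = \<zero> \<longleftrightarrow> (\<forall>i\<in>T. val x i = m i)"
proof
  obtain y where y: "y \<in> carrier Q" "\<forall>i\<in>T. val y i = 0"
    using ex_val[of "\<lambda>_. 0"] by auto
  assume "x = \<zero>"
  then have "x \<otimes> y = \<zero>" using y by simp
  then show "\<forall>i\<in>T. val x i = m i"
    using mult_eq_zero_iff[OF x y(1)] y(2) val_le[OF x] by (simp add: le_antisym)
next
  assume "\<forall>i\<in>T. val x i = m i"
  then have "x \<otimes> \<one> = \<zero>"
    using mult_eq_zero_iff[OF x one_closed] by simp
  then show "x = \<zero>" using x by simp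
qed

lemma pverts_iff:
  "x \<in> pverts (zero_divisor_graph Q) \<longleftrightarrow>
     x \<in> carrier Q \<and> (\<exists>i\<in>T. val x i < m i) \<and> (\<exists>i\<in>T. 0 < val x i)"
proof -
  have "(\<exists>s\<in>carrier Q - {\<zero>}. x \<otimes> s = \<zero>) \<longleftrightarrow> (\<exists>i\<in>T. 0 < val x i)" if x: "x \<in> carrier Q"
  proof
    assume "\<exists>s\<in>carrier Q - {\<zero>}. x \<otimes> s = \<zero>"
    then obtain s where s: "s \<in> carrier Q" "s \<noteq> \<zero>" "x \<otimes> s = \<zero>" by blast
    have sum: "\<forall>i\<in>T. m i \<le> val x i + val s i"
      using s mult_eq_zero_iff[OF x] by blast
    show "\<exists>i\<in>T. 0 < val x i"
    proof (rule ccontr)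
      assume "\<not> (\<exists>i\<in>T. 0 < val x i)"
      then have "\<forall>i\<in>T. val s i = m i"
        using sum val_le[OF s(1)] by (fastforce intro: le_antisym)
      then show False using zero_iff s by blast
    qed
  next
    assume "\<exists>i\<in>T. 0 < val x i"
    then obtain i where i: "i \<in> T" "0 < val x i" by blast
    \<comment> \<open>The element of complementary valuations annihilates \<open>x\<close>; it is
      non-zero because \<open>x\<close> has positive valuation at \<open>i\<close>.\<close>
    obtain s where s: "s \<in> carrier Q" "\<forall>j\<in>T. val s j = m j - val x j"
      using ex_val[of "\<lambda>j. m j - val x j"] by auto
    then have "x \<otimes> s = \<zero>" using mult_eq_zero_iff[OF x] by auto
    moreover have "s \<noteq> \<zero>"
      using i s(2) m_pos[OF i(1)] zero_iff[OF s(1)] by force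
    ultimately show "\<exists>s\<in>carrier Q - {\<zero>}. x \<otimes> s = \<zero>" using s by blast
  qed
  moreover have "x \<noteq> \<zero> \<longleftrightarrow> (\<exists>i\<in>T. val x i < m i)" if x: "x \<in> carrier Q"
    using zero_iff[OF x] val_le[OF x] by (auto simp: less_le)
  ultimately show ?thesis
    by (auto simp: zero_divisor_graph_def zero_divisors_def Let_def)
qed

lemma pvertsI:
  assumes "x \<in> carrier Q" "i \<in> T" "val x i < m i" "j \<in> T" "0 < val x j"
  shows "x \<in> pverts (zero_divisor_graph Q)"
  using assms unfolding pverts_iff by blast

lemma parcs_iff:
  assumes "x \<in> pverts (zero_divisor_graph Q)" "y \<in> pverts (zero_divisor_graph Q)" "x \<noteq> y"
  shows "(x, y) \<in> parcs (zero_divisor_graph Q) \<longleftrightarrow> (\<forall>i\<in>T. m i \<le> val x i + val y i)"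
  using assms mult_eq_zero_iff pverts_iff
  by (auto simp: zero_divisor_graph_def Let_def)

lemma pair_graph_zero_divisor_graph: "pair_graph (zero_divisor_graph Q)"
  using is_cring finite_carrier by (rule zero_divisor_graph_pair_graph)

lemma finite_pverts: "finite (pverts (zero_divisor_graph Q))"
  using finite_carrier by (rule rev_finite_subset) (auto simp: pverts_iff)

section \<open>Bounds for the boxicity in terms of the number of primes\<close>

lemma boxicity_le_card_T: "boxicity (zero_divisor_graph Q) \<le> card T"
proof -
  let ?V = "pverts (zero_divisor_graph Q)"
  have "\<forall>i. \<exists>a b :: 'a \<Rightarrow> real. (\<forall>v\<in>?V. a v \<le> b v) \<and>
      (\<forall>u\<in>?V. \<forall>v\<in>?V. u \<noteq> v \<longrightarrow> (a u \<le> b v \<and> a v \<le> b u \<longleftrightarrow> m i \<le> val u i + val v i))"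
    by (intro allI threshold_intervals finite_pverts)
  then obtain a b :: "'i \<Rightarrow> 'a \<Rightarrow> real" where
    ab: "\<And>i. (\<forall>v\<in>?V. a i v \<le> b i v) \<and> (\<forall>u\<in>?V. \<forall>v\<in>?V. u \<noteq> v \<longrightarrow>
      (a i u \<le> b i v \<and> a i v \<le> b i u \<longleftrightarrow> m i \<le> val u i + val v i))"
    by metis
  show ?thesis
  proof (rule boxicity_le_card[OF pair_graph_zero_divisor_graph finite_T])
    show "a i v \<le> b i v" if "v \<in> ?V" for i v
      using ab that by blast
    show "(u, v) \<in> parcs (zero_divisor_graph Q) \<longleftrightarrow>
        (\<forall>i\<in>T. a i u \<le> b i v \<and> a i v \<le> b i u)"
      if "u \<in> ?V" "v \<in> ?V" "u \<noteq> v" for u v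
      using ab that parcs_iff[OF that] by simp
  qed
qed

text \<open>The coordinate \<open>k\<close> is redundant: two distinct elements of valuation \<open>0\<close> at \<open>k\<close> cannot both
  have full valuation at all the other coordinates, so one of the other interval graphs can
  separate them.\<close>

lemma boxicity_le_card_T_minus_1:
  assumes k: "k \<in> T" "m k = 1" "two k" and m: "\<And>i. i \<in> T \<Longrightarrow> m i \<in> {1, 2}"
  shows "boxicity (zero_divisor_graph Q) \<le> card T - 1"
proof -
  let ?V = "pverts (zero_divisor_graph Q)"
  have carr: "v \<in> carrier Q" if "v \<in> ?V" for v
    using that by (simp add: pverts_iff)
  have "\<forall>i\<in>T. \<exists>a b :: 'a \<Rightarrow> real. (\<forall>v\<in>?V. a v \<le> b v) \<and>
      (\<forall>u\<in>?V. \<forall>v\<in>?V. u \<noteq> v \<longrightarrow> (a u \<le> b v \<and> a v \<le> b u \<longleftrightarrow>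
        m i \<le> val u i + val v i \<and>
        (val u k = 0 \<and> val v k = 0 \<longrightarrow> val u i = m i \<and> val v i = m i)))"
    by (intro ballI split_threshold_intervals finite_pverts m val_le carr)
  then obtain a b :: "'i \<Rightarrow> 'a \<Rightarrow> real" where
    ab: "\<And>i. i \<in> T \<Longrightarrow> (\<forall>v\<in>?V. a i v \<le> b i v) \<and> (\<forall>u\<in>?V. \<forall>v\<in>?V. u \<noteq> v \<longrightarrow>
      (a i u \<le> b i v \<and> a i v \<le> b i u \<longleftrightarrow> m i \<le> val u i + val v i \<and>
        (val u k = 0 \<and> val v k = 0 \<longrightarrow> val u i = m i \<and> val v i = m i)))"
    by metis
  have "boxicity (zero_divisor_graph Q) \<le> card (T - {k})"
  proof (rule boxicity_le_card[OF pair_graph_zero_divisor_graph])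
    show "finite (T - {k})" using finite_T by simp
    show "a i v \<le> b i v" if "i \<in> T - {k}" "v \<in> ?V" for i v
      using ab that by blast
    fix u v
    assume uv: "u \<in> ?V" "v \<in> ?V" "u \<noteq> v"
    have "(\<forall>i\<in>T. m i \<le> val u i + val v i) \<longleftrightarrow>
      (\<forall>i\<in>T - {k}. m i \<le> val u i + val v i \<and>
        (val u k = 0 \<and> val v k = 0 \<longrightarrow> val u i = m i \<and> val v i = m i))"
    proof
      \<comment> \<open>At \<open>k\<close> this excludes that both valuations vanish, since
        \<open>m k = 1\<close>; the extra condition then holds vacuously.\<close>
      assume "\<forall>i\<in>T. m i \<le> val u i + val v i"
      then show "\<forall>i\<in>T - {k}. m i \<le> val u i + val v i \<and>
        (val u k = 0 \<and> val v k = 0 \<longrightarrow> val u i = m i \<and> val v i = m i)"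
        using k by fastforce
    next
      assume *: "\<forall>i\<in>T - {k}. m i \<le> val u i + val v i \<and>
        (val u k = 0 \<and> val v k = 0 \<longrightarrow> val u i = m i \<and> val v i = m i)"
      have "\<not> (val u k = 0 \<and> val v k = 0)"
      proof
        assume 0: "val u k = 0 \<and> val v k = 0"
        have "u = v"
          by (rule val_unique[OF k carr[OF uv(1)] carr[OF uv(2)]]) (use * 0 in auto)
        then show False using uv by blast
      qed
      then have "m k \<le> val u k + val v k" using k by auto
      then show "\<forall>i\<in>T. m i \<le> val u i + val v i" using * by blast
    qed
    then show "(u, v) \<in> parcs (zero_divisor_graph Q) \<longleftrightarrow>
        (\<forall>i\<in>T - {k}. a i u \<le> b i v \<and> a i v \<le> b i u)"
      using ab uv parcs_iff[OF uv] by simp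
  qed
  then show ?thesis using k finite_T by simp
qed

text \<open>For every counted \<open>i\<close>, \<open>ex_two\<close> with \<open>a = 0\<close>
  provides two elements with valuation \<open>0\<close> at \<open>i\<close> and full valuation
  elsewhere. These are not adjacent to each other, but adjacent to all those chosen for other
  indices, so \<open>boxicity_ge_card\<close> applies.\<close>

lemma card_le_boxicity:
  "card {i \<in> T. m i \<ge> 2 \<or> \<not> two i} \<le> boxicity (zero_divisor_graph Q)" (is "card ?S \<le> _")
proof -
  let ?V = "pverts (zero_divisor_graph Q)"
  define P where "P i x y \<longleftrightarrow> x \<in> carrier Q \<and> y \<in> carrier Q \<and> x \<noteq> y \<and>
      (\<forall>j\<in>T. val x j = (if j = i then 0 else m j) \<and> val y j = (if j = i then 0 else m j))"
    for i x y
  have "\<forall>i\<in>?S. \<exists>x y. P i x y"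
  proof
    fix i
    assume "i \<in> ?S"
    then have "i \<in> T" "0 < m i" "Suc 0 < m i \<or> \<not> two i"
      using m_pos[of i] by auto
    from ex_two[OF this] show "\<exists>x y. P i x y"
      unfolding P_def by blast
  qed
  then obtain x y where "\<forall>i\<in>?S. P i (x i) (y i)"
    by metis
  then have xy: "x i \<in> carrier Q \<and> y i \<in> carrier Q \<and> x i \<noteq> y i \<and>
      (\<forall>j\<in>T. val (x i) j = (if j = i then 0 else m j) \<and> val (y i) j = (if j = i then 0 else m j))"
    if "i \<in> ?S" for i
    using that unfolding P_def by blast
  have V: "x i \<in> ?V" "y i \<in> ?V" if i: "i \<in> ?S" for i
  proof -
    obtain j where j: "j \<in> T" "j \<noteq> i" using ex_other i by blast
    have iT: "i \<in> T" using i by simp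
    have "val (x i) i < m i" "0 < val (x i) j" "val (y i) i < m i" "0 < val (y i) j"
      using xy[OF i] m_pos[OF j(1)] m_pos[OF iT] iT j by simp_all
    then show "x i \<in> ?V" "y i \<in> ?V"
      using pvertsI[OF _ iT _ j(1)] xy[OF i] by blast+
  qed
  show ?thesis
  proof (rule boxicity_ge_card[OF pair_graph_zero_divisor_graph _ V])
    show "finite ?S" using finite_T by simp
    fix i
    assume i: "i \<in> ?S"
    show "x i \<noteq> y i" using xy[OF i] by blast
    have "val (x i) i + val (y i) i < m i" "i \<in> T"
      using xy[OF i] i m_pos[of i] by auto
    then show "(x i, y i) \<notin> parcs (zero_divisor_graph Q)"
      using parcs_iff[OF V[OF i] \<open>x i \<noteq> y i\<close>] not_le by blast
  next
    fix i j
    assume ij: "i \<in> ?S" "j \<in> ?S" "i \<noteq> j"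
    have arc: "(u, v) \<in> parcs (zero_divisor_graph Q)"
      if "u \<in> {x i, y i}" "v \<in> {x j, y j}" for u v
    proof -
      have val: "\<forall>l\<in>T. val u l = (if l = i then 0 else m l) \<and> val v l = (if l = j then 0 else m l)"
        using xy[OF ij(1)] xy[OF ij(2)] that by auto
      have "val u i \<noteq> val v i" using val ij m_pos[of i] by auto
      then have "u \<noteq> v" by blast
      moreover have "u \<in> ?V" "v \<in> ?V" using that V[OF ij(1)] V[OF ij(2)] by blast+
      moreover have "\<forall>l\<in>T. m l \<le> val u l + val v l" using val ij(3) by auto
      ultimately show ?thesis using parcs_iff[of u v] by blast
    qed
    show "(x i, x j) \<in> parcs (zero_divisor_graph Q) \<and> (x i, y j) \<in> parcs (zero_divisor_graph Q) \<and>
        (y i, y j) \<in> parcs (zero_divisor_graph Q)"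
      by (simp add: arc)
  qed
qed

text \<open>With \<open>m c \<ge> 3\<close>, the second element of each separated pair can be taken of valuation
  \<open>m c - 1\<close> at \<open>c\<close>, as the pair belonging to \<open>c\<close> itself may have valuation \<open>1\<close> there.\<close>

lemma card_T_le_boxicity:
  assumes c: "c \<in> T" "m c \<ge> 3"
  shows "card T \<le> boxicity (zero_divisor_graph Q)"
proof -
  let ?V = "pverts (zero_divisor_graph Q)"
  define w where "w i j = (if j = i then if i = c then 1 else 0 else m j)" for i j
  \<comment> \<open>For \<open>i \<noteq> c\<close> the families \<open>w\<close> and
    \<open>w'\<close> differ only at \<open>c\<close>. This supplies a second element even if
    \<open>m i = 1\<close> and \<open>two i\<close>, where only one has the valuations
    \<open>w i\<close>. For \<open>i = c\<close> they agree, and \<open>ex_two\<close> with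
    \<open>a = 1\<close> gives the two elements.\<close>
  define w' where "w' i j = (if j = i then if i = c then 1 else 0 else if j = c then m c - 1 else m j)"
    for i j
  define P where "P i x y \<longleftrightarrow> x \<in> carrier Q \<and> y \<in> carrier Q \<and> x \<noteq> y \<and>
      (\<forall>j\<in>T. val x j = w i j \<and> val y j = w' i j)" for i x y
  have "\<exists>x y. P i x y" if i: "i \<in> T" for i
  proof (cases "i = c")
    case True
    have "1 < m c" "Suc 1 < m c \<or> \<not> two c" using c by auto
    moreover have "w i j = (if j = c then 1 else m j)" "w' i j = (if j = c then 1 else m j)" for j
      using True by (auto simp: w_def w'_def)
    ultimately show ?thesis
      using ex_two[OF c(1), of 1] unfolding P_def by (simp only:) blast
  next
    case False
    then have "w i j \<le> m j" "w' i j \<le> m j" for j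
      by (simp_all add: w_def w'_def)
    note le = this
    obtain x where x: "x \<in> carrier Q" "\<forall>j\<in>T. val x j = w i j"
      using ex_val[of "w i"] le by blast
    obtain y where y: "y \<in> carrier Q" "\<forall>j\<in>T. val y j = w' i j"
      using ex_val[of "w' i"] le by blast
    have "w i c \<noteq> w' i c" using False c by (simp add: w_def w'_def)
    then have "x \<noteq> y" using x(2) y(2) c by metis
    then show ?thesis using x y unfolding P_def by blast
  qed
  then obtain x y where "\<forall>i\<in>T. P i (x i) (y i)"
    by metis
  then have xy: "x i \<in> carrier Q \<and> y i \<in> carrier Q \<and> x i \<noteq> y i \<and>
      (\<forall>j\<in>T. val (x i) j = w i j \<and> val (y i) j = w' i j)" if "i \<in> T" for i
    using that unfolding P_def by blast
  have V: "x i \<in> ?V" "y i \<in> ?V" if i: "i \<in> T" for i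
  proof -
    obtain j where j: "j \<in> T" "j \<noteq> i" using ex_other i by blast
    have "w i i < m i" "0 < w i j" "w' i i < m i" "0 < w' i j"
      using m_pos[OF i] m_pos[OF j(1)] j c by (auto simp: w_def w'_def)
    then have "val (x i) i < m i" "0 < val (x i) j" "val (y i) i < m i" "0 < val (y i) j"
      using xy[OF i] i j(1) by simp_all
    then show "x i \<in> ?V" "y i \<in> ?V"
      using pvertsI[OF _ i _ j(1)] xy[OF i] by blast+
  qed
  show ?thesis
  proof (rule boxicity_ge_card[OF pair_graph_zero_divisor_graph finite_T V])
    fix i
    assume i: "i \<in> T"
    show "x i \<noteq> y i" using xy[OF i] by blast
    \<comment> \<open>The sum is \<open>0\<close> for \<open>i \<noteq> c\<close> and
      \<open>2\<close> for \<open>i = c\<close>, where \<open>m c \<ge> 3\<close> is needed.\<close>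
    have "w i i + w' i i < m i" using c m_pos[OF i] by (auto simp: w_def w'_def)
    then have "val (x i) i + val (y i) i < m i"
      using xy[OF i] i by simp
    then show "(x i, y i) \<notin> parcs (zero_divisor_graph Q)"
      using parcs_iff[OF V[OF i] \<open>x i \<noteq> y i\<close>] i not_le by blast
  next
    fix i j
    assume ij: "i \<in> T" "j \<in> T" "i \<noteq> j"
    have arc: "(u, v) \<in> parcs (zero_divisor_graph Q)"
      if uv: "u \<in> {x i, y i}" "v \<in> {x j, y j}" for u v
    proof -
      have val: "\<forall>l\<in>T. (val u l = w i l \<or> val u l = w' i l) \<and> (val v l = w j l \<or> val v l = w' j l)"
        using xy[OF ij(1)] xy[OF ij(2)] that by auto
      have "w i i < w j i" "w' i i < w j i" "w i i < w' j i" "w' i i < w' j i"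
        using ij c m_pos[of i] by (auto simp: w_def w'_def)
      then have "val u i \<noteq> val v i"
        using val[rule_format, OF ij(1)] by (elim conjE disjE) simp_all
      then have "u \<noteq> v" by blast
      moreover have "u \<in> ?V" "v \<in> ?V" using that V[OF ij(1)] V[OF ij(2)] by blast+
      moreover have "m l \<le> val u l + val v l" if "l \<in> T" for l
      proof -
        \<comment> \<open>At \<open>l = c\<close> the smallest sums are
          \<open>1 + (m c - 1)\<close>, if \<open>c\<close> is one of \<open>i\<close> and
          \<open>j\<close>, and \<open>2 * (m c - 1)\<close> otherwise.\<close>
        have "m l \<le> w i l + w j l" "m l \<le> w i l + w' j l" "m l \<le> w' i l + w j l"
          "m l \<le> w' i l + w' j l"
          using ij c by (auto simp: w_def w'_def)
        then show ?thesis using val[rule_format, OF that] by (elim conjE disjE) simp_all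
      qed
      ultimately show ?thesis using parcs_iff[of u v] by blast
    qed
    show "(x i, x j) \<in> parcs (zero_divisor_graph Q) \<and> (x i, y j) \<in> parcs (zero_divisor_graph Q) \<and>
        (y i, y j) \<in> parcs (zero_divisor_graph Q)"
      by (simp add: arc)
  qed
qed

text \<open>In the family \<open>F\<close>, non-emptiness of \<open>S\<close> makes
  \<open>e S\<close> non-zero and properness makes it a zero divisor, so the disjointness graph sits
  in the zero divisor graph as an induced subgraph.\<close>

lemma card_T_minus_1_le_boxicity:
  assumes "card T \<ge> 3"
  shows "card T - 1 \<le> boxicity (zero_divisor_graph Q)"
proof -
  let ?V = "pverts (zero_divisor_graph Q)"
  define F where "F = {S. S \<noteq> {} \<and> S \<subset> T}"
  have "\<exists>x\<in>carrier Q. \<forall>i\<in>T. val x i = (if i \<in> S then 0 else m i)" for S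
    by (rule ex_val) simp
  then obtain e where e: "\<And>S. e S \<in> carrier Q"
    and val: "\<And>S i. i \<in> T \<Longrightarrow> val (e S) i = (if i \<in> S then 0 else m i)"
    by metis
  have V: "e S \<in> ?V" if S: "S \<in> F" for S
  proof -
    obtain i j where "i \<in> S" "i \<in> T" "j \<in> T" "j \<notin> S" using S by (auto simp: F_def)
    then show ?thesis
      using val[of i S] val[of j S] m_pos[of i] m_pos[of j] by (intro pvertsI[OF e, of i _ j]) auto
  qed
  have inj: "inj_on e F"
  proof (rule inj_onI)
    fix S S'
    assume S: "S \<in> F" "S' \<in> F" "e S = e S'"
    have "i \<in> S \<longleftrightarrow> i \<in> S'" if "i \<in> T" for i
      using val[OF that, of S] val[OF that, of S'] S(3) m_pos[OF that] by (auto split: if_splits)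
    then show "S = S'" using S by (auto simp: F_def)
  qed
  show ?thesis
  proof (rule boxicity_ge_disjointness[OF pair_graph_zero_divisor_graph finite_T assms F_def V inj])
    fix S S'
    assume S: "S \<in> F" "S' \<in> F" "S \<noteq> S'"
    have ne: "e S \<noteq> e S'" using inj S by (auto simp: inj_on_def)
    have "m i \<le> val (e S) i + val (e S') i \<longleftrightarrow> i \<notin> S \<inter> S'" if "i \<in> T" for i
      using val[OF that] m_pos[OF that] by auto
    then have "(\<forall>i\<in>T. m i \<le> val (e S) i + val (e S') i) \<longleftrightarrow> S \<inter> S' = {}"
      using S by (auto simp: F_def)
    then show "(e S, e S') \<in> parcs (zero_divisor_graph Q) \<longleftrightarrow> S \<inter> S' = {}"
      using parcs_iff[OF V[OF S(1)] V[OF S(2)] ne] by blast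
  qed
qed

text \<open>A vertex has valuations \<open>(0, 1)\<close> or \<open>(1, 0)\<close>, each realised by
  only one element. Distinct vertices are therefore of different type and adjacent: the graph is
  complete.\<close>

lemma boxicity_eq_0:
  assumes T: "T = {i, k}" "i \<noteq> k" and m: "m i = 1" "m k = 1" and two: "two i" "two k"
  shows "boxicity (zero_divisor_graph Q) = 0"
proof -
  let ?V = "pverts (zero_divisor_graph Q)"
  have vert: "x \<in> carrier Q" "val x i = 0 \<and> val x k = 1 \<or> val x i = 1 \<and> val x k = 0"
    if "x \<in> ?V" for x
    using that val_le[of x i] val_le[of x k] m T unfolding pverts_iff by auto
  have uniq_i: "x = y" if "x \<in> ?V" "y \<in> ?V" "val x i = 0" "val y i = 0" for x y
    by (rule val_unique[of i]) (use that vert[OF that(1)] vert[OF that(2)] T m two in auto)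
  have uniq_k: "x = y" if "x \<in> ?V" "y \<in> ?V" "val x k = 0" "val y k = 0" for x y
    by (rule val_unique[of k]) (use that vert[OF that(1)] vert[OF that(2)] T m two in auto)
  have "(x, y) \<in> parcs (zero_divisor_graph Q)" if xy: "x \<in> ?V" "y \<in> ?V" "x \<noteq> y" for x y
  proof -
    have "val x i + val y i = 1" "val x k + val y k = 1"
      using vert(2)[OF xy(1)] vert(2)[OF xy(2)] uniq_i[OF xy(1,2)] uniq_k[OF xy(1,2)] xy(3) by auto
    then show ?thesis using parcs_iff[OF xy] T m by simp
  qed
  then have "parcs (zero_divisor_graph Q) = vertex_pairs ?V"
    using pair_graph_parcs_subset[OF pair_graph_zero_divisor_graph] by (auto simp: vertex_pairs_def)
  then show ?thesis
    using boxicity_eq_0_iff[OF pair_graph_zero_divisor_graph] by blast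
qed

end

section \<open>Prime powers in an integral domain\<close>

context domain
begin

lemma ring_primeD:
  assumes "ring_prime p"
  shows "p \<noteq> \<zero>" "p \<notin> Units R"
    and "\<And>x y. x \<in> carrier R \<Longrightarrow> y \<in> carrier R \<Longrightarrow> p divides x \<otimes> y \<Longrightarrow> p divides x \<or> p divides y"
  using assms by (auto simp: ring_prime_def prime_def)

lemma nat_pow_nonzero:
  assumes "p \<in> carrier R" "p \<noteq> \<zero>"
  shows "p [^] (n :: nat) \<noteq> \<zero>"
  using assms by (induction n) (auto simp: integral_iff)

lemma divides_lcancel:
  assumes "a \<in> carrier R" "a \<noteq> \<zero>" "x \<in> carrier R" "y \<in> carrier R"
  shows "a \<otimes> x divides a \<otimes> y \<longleftrightarrow> x divides y"
proof
  assume "a \<otimes> x divides a \<otimes> y"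
  then obtain c where c: "c \<in> carrier R" "a \<otimes> y = a \<otimes> x \<otimes> c"
    by (auto elim: dividesE)
  then have "a \<otimes> y = a \<otimes> (x \<otimes> c)" using assms by (simp add: m_assoc)
  then have "y = x \<otimes> c" using assms c m_lcancel[of a y "x \<otimes> c"] by simp
  then show "x divides y" using c by (intro dividesI)
qed (use assms in \<open>auto intro: divides_mult_lI\<close>)

lemma divides_minus:
  assumes "d \<in> carrier R" "x \<in> carrier R" "y \<in> carrier R" "d divides x" "d divides y"
  shows "d divides (x \<ominus> y)"
proof -
  obtain a b where "a \<in> carrier R" "b \<in> carrier R" "x = d \<otimes> a" "y = d \<otimes> b"
    using assms by (auto elim!: dividesE)
  then have "x \<ominus> y = d \<otimes> (a \<ominus> b)" using assms(1) by (simp add: r_distr minus_eq r_minus)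
  then show ?thesis using \<open>a \<in> carrier R\<close> \<open>b \<in> carrier R\<close> by (intro dividesI[of "a \<ominus> b"]) auto
qed

lemma divides_minus_cancel:
  assumes "d \<in> carrier R" "x \<in> carrier R" "y \<in> carrier R" "d divides (x \<ominus> y)"
  shows "d divides x \<longleftrightarrow> d divides y"
proof
  assume "d divides x"
  then have "d divides (x \<ominus> (x \<ominus> y))"
    using assms by (intro divides_minus[of d x "x \<ominus> y"]) auto
  moreover have "x \<ominus> (x \<ominus> y) = y" using assms by algebra
  ultimately show "d divides y" by simp
next
  assume "d divides y"
  moreover have "d divides \<zero>" using assms by (intro dividesI[of \<zero>]) auto
  ultimately have "d divides (\<zero> \<ominus> y)"
    using assms by (intro divides_minus) auto
  then have "d divides ((x \<ominus> y) \<ominus> (\<zero> \<ominus> y))"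
    using assms by (intro divides_minus[of d "x \<ominus> y" "\<zero> \<ominus> y"]) auto
  moreover have "(x \<ominus> y) \<ominus> (\<zero> \<ominus> y) = x" using assms by algebra
  ultimately show "d divides x" by simp
qed

lemma mem_cgenideal_iff:
  assumes "d \<in> carrier R"
  shows "x \<in> PIdl d \<longleftrightarrow> x \<in> carrier R \<and> d divides x"
  using assms by (auto simp: cgenideal_def factor_def m_comm)

lemma coset_eq_iff:
  assumes "d \<in> carrier R" "x \<in> carrier R" "y \<in> carrier R"
  shows "PIdl d +> x = PIdl d +> y \<longleftrightarrow> d divides (x \<ominus> y)"
  using quotient_eq_iff_same_a_r_cos[OF cgenideal_ideal[OF assms(1)] assms(2,3)]
    mem_cgenideal_iff[OF assms(1)] assms by auto

lemma carrier_FactRing_cgenideal: "carrier (R Quot (PIdl d)) = (\<lambda>x. PIdl d +> x) ` carrier R"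
  unfolding FactRing_simps by auto

text \<open>The cosets of \<open>0\<close> and \<open>1\<close> differ because \<open>p\<close> is
  not a unit, so the condition says that there are no further cosets.\<close>

lemma card_residue_ring_eq_2_iff:
  assumes p: "p \<in> carrier R" "ring_prime p"
  shows "card (carrier (R Quot (PIdl p))) = 2 \<longleftrightarrow>
    (\<forall>c\<in>carrier R. p divides c \<or> p divides (\<one> \<ominus> c))"
proof -
  let ?C = "\<lambda>x. PIdl p +> x"
  have coset0: "?C c = ?C \<zero> \<longleftrightarrow> p divides c" if "c \<in> carrier R" for c
    using coset_eq_iff[OF p(1) that zero_closed] that by (simp add: minus_eq)
  have coset1: "?C c = ?C \<one> \<longleftrightarrow> p divides (\<one> \<ominus> c)" if "c \<in> carrier R" for c
    using coset_eq_iff[OF p(1) one_closed that] by auto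
  have "\<not> p divides \<one>"
    using ring_primeD(2)[OF p(2)] Unit_eq_dividesone[OF p(1)] by simp
  then have "?C \<one> \<noteq> ?C \<zero>"
    using coset0 by simp
  then have two: "card {?C \<zero>, ?C \<one>} = 2"
    by (simp add: card_insert_if)
  have sub: "{?C \<zero>, ?C \<one>} \<subseteq> carrier (R Quot (PIdl p))"
    unfolding carrier_FactRing_cgenideal by blast
  have "card (carrier (R Quot (PIdl p))) = 2 \<longleftrightarrow> carrier (R Quot (PIdl p)) = {?C \<zero>, ?C \<one>}"
    \<comment> \<open>An infinite carrier has \<open>card\<close> equal to \<open>0\<close>, so
      cardinality \<open>2\<close> includes finiteness.\<close>
    using two sub by (metis card_subset_eq card.infinite zero_neq_numeral)
  also have "\<dots> \<longleftrightarrow> (\<forall>c\<in>carrier R. p divides c \<or> p divides (\<one> \<ominus> c))"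
  proof -
    have "?C ` carrier R = {?C \<zero>, ?C \<one>} \<longleftrightarrow> (\<forall>c\<in>carrier R. ?C c = ?C \<zero> \<or> ?C c = ?C \<one>)"
      using zero_closed one_closed by blast
    then show ?thesis
      unfolding carrier_FactRing_cgenideal using coset0 coset1 by simp
  qed
  finally show ?thesis .
qed

text \<open>Additivity of the valuation, phrased by splitting exponents so that \<open>x\<close> or
  \<open>y\<close> may be zero. In the induction, cancelling \<open>p [^] k\<close> leaves
  \<open>p\<close> dividing the product of the cofactors, and by primality one of them absorbs
  it.\<close>

lemma pow_divides_mult_iff:
  assumes p: "p \<in> carrier R" "ring_prime p" and xy: "x \<in> carrier R" "y \<in> carrier R"
  shows "p [^] (k :: nat) divides x \<otimes> y \<longleftrightarrow>
    (\<exists>a b. a + b = k \<and> p [^] a divides x \<and> p [^] b divides y)"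
proof
  show "p [^] k divides x \<otimes> y" if ex: "\<exists>a b. a + b = k \<and> p [^] a divides x \<and> p [^] b divides y"
  proof -
    obtain a b c d where "a + b = k" "c \<in> carrier R" "x = p [^] a \<otimes> c" "d \<in> carrier R"
      "y = p [^] b \<otimes> d"
      using ex unfolding factor_def by blast
    moreover from this have "x \<otimes> y = p [^] k \<otimes> (c \<otimes> d)"
      using p(1) by (auto simp: nat_pow_mult[symmetric] m_ac)
    ultimately show ?thesis by (intro dividesI[of "c \<otimes> d"]) auto
  qed
  show "\<exists>a b. a + b = k \<and> p [^] a divides x \<and> p [^] b divides y" if "p [^] k divides x \<otimes> y"
    using that
  proof (induction k)
    case 0
    then show ?case using xy by (auto intro: one_divides)
  next
    case (Suc k)
    have "p [^] k divides p [^] Suc k"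
      using p(1) by (intro dividesI[of p]) auto
    then have "p [^] k divides x \<otimes> y"
      using Suc.prems divides_trans p(1) xy by (meson m_closed nat_pow_closed)
    then obtain a b where ab: "a + b = k" "p [^] a divides x" "p [^] b divides y"
      using Suc.IH by blast
    then obtain c d where cd: "c \<in> carrier R" "x = p [^] a \<otimes> c" "d \<in> carrier R" "y = p [^] b \<otimes> d"
      by (auto elim!: dividesE)
    have "x \<otimes> y = p [^] k \<otimes> (c \<otimes> d)"
      using p(1) cd ab(1) by (auto simp: nat_pow_mult[symmetric] m_ac)
    moreover have "p [^] Suc k = p [^] k \<otimes> p"
      by simp
    ultimately have "p divides c \<otimes> d"
      using Suc.prems divides_lcancel[of "p [^] k" p "c \<otimes> d"] p(1) cd
        nat_pow_nonzero[OF p(1) ring_primeD(1)[OF p(2)]] by simp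
    then consider "p divides c" | "p divides d"
      using ring_primeD(3)[OF p(2) cd(1,3)] by blast
    then show ?case
    proof cases
      case 1
      then have "p [^] Suc a divides x"
        unfolding cd(2) nat_pow_Suc using p(1) cd(1) by (intro divides_mult_lI) auto
      then show ?thesis using ab by (intro exI[of _ "Suc a"] exI[of _ b]) auto
    next
      case 2
      then have "p [^] Suc b divides y"
        unfolding cd(4) nat_pow_Suc using p(1) cd(3) by (intro divides_mult_lI) auto
      then show ?thesis using ab by (intro exI[of _ a] exI[of _ "Suc b"]) auto
    qed
  qed
qed

lemma pow_divides_pow:
  assumes "p \<in> carrier R" "a \<le> b"
  shows "p [^] (a :: nat) divides p [^] (b :: nat)"
  using assms nat_pow_mult[of p a "b - a"] by (intro dividesI[of "p [^] (b - a)"]) auto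

lemma pow_divides_antimono:
  assumes "p \<in> carrier R" "x \<in> carrier R" "p [^] (b :: nat) divides x" "a \<le> b"
  shows "p [^] a divides x"
  by (rule divides_trans[OF pow_divides_pow[OF assms(1,4)] assms(3) nat_pow_closed[OF assms(1)]])

lemma pow_divides_mult_coprime_iff:
  assumes p: "p \<in> carrier R" "ring_prime p" and xy: "x \<in> carrier R" "y \<in> carrier R"
    and np: "\<not> p divides x"
  shows "p [^] (k :: nat) divides x \<otimes> y \<longleftrightarrow> p [^] k divides y"
proof -
  have zero: "a = 0" if "p [^] (a :: nat) divides x" for a
  proof (rule ccontr)
    assume "a \<noteq> 0"
    then have "p [^] (1 :: nat) divides x"
      by (intro pow_divides_antimono[OF p(1) xy(1) that]) simp
    then show False using np p(1) by simp
  qed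
  have "p [^] (0 :: nat) divides x" using one_divides[OF xy(1)] by simp
  show ?thesis
  proof
    assume "p [^] k divides x \<otimes> y"
    then show "p [^] k divides y"
      unfolding pow_divides_mult_iff[OF p xy] using zero by (metis add_0)
  qed (use xy p in \<open>simp add: divides_prod_l\<close>)
qed

lemma pow_divides_pow_iff:
  assumes p: "p \<in> carrier R" "ring_prime p"
  shows "p [^] (a :: nat) divides p [^] (b :: nat) \<longleftrightarrow> a \<le> b"
proof
  assume d: "p [^] a divides p [^] b"
  show "a \<le> b"
  proof (rule ccontr)
    assume "\<not> a \<le> b"
    then have "p [^] Suc b divides p [^] b"
      by (intro pow_divides_antimono[OF p(1) nat_pow_closed[OF p(1)] d]) simp
    then have "p [^] b \<otimes> p divides p [^] b \<otimes> \<one>"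
      using p(1) by simp
    then have "p divides \<one>"
      using divides_lcancel[OF nat_pow_closed[OF p(1)]
          nat_pow_nonzero[OF p(1) ring_primeD(1)[OF p(2)]] p(1) one_closed] by blast
    then show False
      using Unit_eq_dividesone[OF p(1)] ring_primeD(2)[OF p(2)] by simp
  qed
qed (rule pow_divides_pow[OF p(1)])

lemma prime_divides_pow:
  assumes p: "ring_prime p" and q: "q \<in> carrier R" and pc: "p \<in> carrier R"
    and "p divides q [^] (k :: nat)"
  shows "p divides q"
  using assms(4)
proof (induction k)
  case 0
  then show ?case using Unit_eq_dividesone[OF pc] ring_primeD(2)[OF p] by simp
next
  case (Suc k)
  then show ?case using ring_primeD(3)[OF p _ q, of "q [^] k"] q by auto
qed

text \<open>With \<open>q\<close> written as \<open>p\<close> times \<open>c\<close>, the prime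
  \<open>q\<close> divides \<open>p\<close> or \<open>c\<close>; the latter would make
  \<open>p\<close> a unit.\<close>

lemma prime_divides_prime:
  assumes p: "p \<in> carrier R" "ring_prime p" and q: "q \<in> carrier R" "ring_prime q"
    and "p divides q"
  shows "p \<sim> q"
proof -
  obtain c where c: "c \<in> carrier R" "q = p \<otimes> c"
    using assms(5) by (auto elim: dividesE)
  have "q divides p \<otimes> c" using c q by auto
  then consider "q divides p" | "q divides c"
    using ring_primeD(3)[OF q(2) p(1) c(1)] by blast
  then show ?thesis
  proof cases
    case 1
    then show ?thesis by (rule associatedI[OF assms(5)])
  next
    case 2
    then obtain d where d: "d \<in> carrier R" "c = q \<otimes> d"
      by (auto elim: dividesE)
    have "q \<otimes> \<one> = q \<otimes> (p \<otimes> d)"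
      using c(2) m_lcomm[OF p(1) q(1) d(1)] q(1) unfolding d(2) by simp
    then have "\<one> = p \<otimes> d"
      using m_lcancel[of q \<one> "p \<otimes> d"] ring_primeD(1)[OF q(2)] q p d by simp
    then have "p divides \<one>" using d by (intro dividesI)
    then show ?thesis using Unit_eq_dividesone[OF p(1)] ring_primeD(2)[OF p(2)] by simp
  qed
qed

text \<open>The \<open>p\<close>-adic valuation truncated at \<open>k\<close>. The cap keeps it
  finite at zero and makes it invariant under adding multiples of \<open>p [^] k\<close>, so that it
  descends to the quotient.\<close>

definition capped_val :: "'a \<Rightarrow> nat \<Rightarrow> 'a \<Rightarrow> nat" where
  "capped_val p k x = Max {j. j \<le> k \<and> p [^] j divides x}"

lemma capped_val_mem:
  assumes "p \<in> carrier R" "x \<in> carrier R"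
  shows "capped_val p k x \<le> k" "p [^] capped_val p k x divides x"
proof -
  have "p [^] (0 :: nat) divides x" using assms by (auto intro: one_divides)
  then have "capped_val p k x \<in> {j. j \<le> k \<and> p [^] j divides x}"
    unfolding capped_val_def by (intro Max_in) auto
  then show "capped_val p k x \<le> k" "p [^] capped_val p k x divides x" by auto
qed

lemma le_capped_val_iff:
  assumes "p \<in> carrier R" "x \<in> carrier R" "j \<le> k"
  shows "j \<le> capped_val p k x \<longleftrightarrow> p [^] j divides x"
proof
  show "p [^] j divides x" if "j \<le> capped_val p k x"
    using pow_divides_antimono[OF assms(1,2) capped_val_mem(2)[OF assms(1,2)] that] .
  show "j \<le> capped_val p k x" if "p [^] j divides x"
    unfolding capped_val_def using that assms(3) by (intro Max_ge) auto
qed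

text \<open>Truncation loses nothing, since the exponents in a splitting of \<open>k\<close> do not
  exceed \<open>k\<close>.\<close>

lemma pow_divides_mult_capped_val:
  assumes p: "p \<in> carrier R" "ring_prime p" and xy: "x \<in> carrier R" "y \<in> carrier R"
  shows "p [^] k divides x \<otimes> y \<longleftrightarrow> k \<le> capped_val p k x + capped_val p k y"
proof
  assume "p [^] k divides x \<otimes> y"
  then obtain a b where ab: "a + b = k" "p [^] a divides x" "p [^] b divides y"
    unfolding pow_divides_mult_iff[OF p xy] by blast
  then have "a \<le> capped_val p k x" "b \<le> capped_val p k y"
    using le_capped_val_iff[OF p(1) xy(1), of a k] le_capped_val_iff[OF p(1) xy(2), of b k] by auto
  then show "k \<le> capped_val p k x + capped_val p k y" using ab by simp
next
  assume "k \<le> capped_val p k x + capped_val p k y"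
  moreover have "p [^] (capped_val p k x + capped_val p k y) divides x \<otimes> y"
    using capped_val_mem(2)[OF p(1) xy(1)] capped_val_mem(2)[OF p(1) xy(2)]
      pow_divides_mult_iff[OF p xy] by blast
  ultimately show "p [^] k divides x \<otimes> y"
    using pow_divides_antimono[OF p(1) m_closed[OF xy]] by blast
qed

end

section \<open>The quotient by a product of prime powers\<close>

locale prime_power_quotient = domain R for R (structure) +
  fixes T :: "'i set" and p :: "'i \<Rightarrow> 'a" and m :: "'i \<Rightarrow> nat" and u :: 'a
  assumes finite_T: "finite T"
    and card_T: "card T \<ge> 2"
    and p_closed: "i \<in> T \<Longrightarrow> p i \<in> carrier R"
    and p_prime: "i \<in> T \<Longrightarrow> ring_prime (p i)"
    and p_not_assoc: "i \<in> T \<Longrightarrow> j \<in> T \<Longrightarrow> i \<noteq> j \<Longrightarrow> \<not> p i \<sim> p j"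
    and m_pos: "i \<in> T \<Longrightarrow> m i \<ge> 1"
    and u_unit: "u \<in> Units R"
begin

text \<open>The exponents are a parameter because such products serve both as generator of the ideal
  and as representatives with prescribed valuations; the index set varies for inductions.\<close>

definition pp :: "('i \<Rightarrow> nat) \<Rightarrow> 'i set \<Rightarrow> 'a" where
  "pp w S = (\<Otimes>i\<in>S. p i [^] w i)"

definition g :: 'a where
  "g = u \<otimes> pp m T"

abbreviation Q :: "'a set ring" where
  "Q \<equiv> R Quot (PIdl g)"

text \<open>Any representative may be taken; \<open>val_coset\<close> shows that the choice is
  immaterial.\<close>

definition val :: "'a set \<Rightarrow> 'i \<Rightarrow> nat" where
  "val X i = capped_val (p i) (m i) (SOME x. x \<in> X)"

definition two :: "'i \<Rightarrow> bool" where
  "two i \<longleftrightarrow> card (carrier (R Quot (PIdl (p i)))) = 2"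

section \<open>Divisibility by products of prime powers\<close>

lemma pp_closed: "S \<subseteq> T \<Longrightarrow> pp w S \<in> carrier R"
  unfolding pp_def by (intro finprod_closed) (auto simp: p_closed)

lemma g_closed: "g \<in> carrier R"
  using pp_closed[of T m] Units_closed[OF u_unit] by (simp add: g_def)

lemma pp_insert:
  assumes "i \<in> T" "S \<subseteq> T" "i \<notin> S"
  shows "pp w (insert i S) = p i [^] w i \<otimes> pp w S"
  unfolding pp_def using assms finite_subset[OF assms(2) finite_T]
  by (intro finprod_insert) (auto simp: p_closed)

lemma not_divides_pp:
  assumes i: "i \<in> T" and S: "S \<subseteq> T" "i \<notin> S"
  shows "\<not> p i divides pp w S"
  using finite_subset[OF S(1) finite_T] S
proof (induction S)
  case empty
  then show ?case
    using Unit_eq_dividesone[OF p_closed[OF i]] ring_primeD(2)[OF p_prime[OF i]] by (simp add: pp_def)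
next
  case (insert j S)
  then have j: "j \<in> T" "S \<subseteq> T" "j \<notin> S" "i \<noteq> j" by auto
  have "\<not> p i divides p j"
    using prime_divides_prime p_not_assoc[OF i j(1,4)] p_closed p_prime i j(1) by blast
  then have "\<not> p i divides p j [^] w j"
    using prime_divides_pow p_closed p_prime i j(1) by blast
  then show ?case
    using ring_primeD(3)[OF p_prime[OF i], of "p j [^] w j" "pp w S"] insert j p_closed[OF j(1)]
    by (auto simp: pp_insert pp_closed)
qed

text \<open>In the induction step \<open>z\<close> is \<open>pp w S\<close> times a cofactor. As
  \<open>p i\<close> does not divide \<open>pp w S\<close>, the power of \<open>p i\<close> dividing
  \<open>z\<close> already divides the cofactor.\<close>

lemma pp_divides_iff:
  assumes z: "z \<in> carrier R" and S: "S \<subseteq> T"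
  shows "pp w S divides z \<longleftrightarrow> (\<forall>i\<in>S. p i [^] w i divides z)"
  using finite_subset[OF S finite_T] S
proof (induction S)
  case empty
  then show ?case using z by (auto simp: pp_def intro: one_divides)
next
  case (insert i S)
  then have i: "i \<in> T" "S \<subseteq> T" "i \<notin> S" by auto
  note cl = p_closed[OF i(1)] pp_closed[OF i(2), of w]
  have pow: "p i [^] w i \<in> carrier R" using cl by simp
  show ?case
  proof
    assume d: "pp w (insert i S) divides z"
    have "p i [^] w i divides pp w (insert i S)" "pp w S divides pp w (insert i S)"
      unfolding pp_insert[OF i] using cl by (auto intro: divides_prod_r divides_prod_l)
    then have "p i [^] w i divides z" "pp w S divides z"
      using divides_trans[OF _ d] cl pow by auto
    then show "\<forall>j\<in>insert i S. p j [^] w j divides z" using insert i by auto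
  next
    assume d: "\<forall>j\<in>insert i S. p j [^] w j divides z"
    then have "pp w S divides z" using insert i by auto
    then obtain c where c: "c \<in> carrier R" "z = pp w S \<otimes> c" by (auto elim: dividesE)
    then have "p i [^] w i divides c"
      using d pow_divides_mult_coprime_iff[OF cl(1) p_prime[OF i(1)] cl(2) c(1)
          not_divides_pp[OF i]] by simp
    then have "pp w S \<otimes> p i [^] w i divides z"
      unfolding c(2) using cl c by (intro divides_mult_lI) auto
    then show "pp w (insert i S) divides z"
      unfolding pp_insert[OF i] using cl by (simp add: m_comm)
  qed
qed

lemma g_divides_iff:
  assumes z: "z \<in> carrier R"
  shows "g divides z \<longleftrightarrow> (\<forall>i\<in>T. p i [^] m i divides z)"
proof -
  have cl: "pp m T \<in> carrier R" "u \<in> carrier R"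
    using pp_closed Units_closed[OF u_unit] by auto
  have "g = pp m T \<otimes> u"
    using cl by (simp add: g_def m_comm)
  then have assoc: "g \<sim> pp m T"
    using associatedI2[OF u_unit _ cl(1)] by blast
  have "g divides z \<longleftrightarrow> pp m T divides z"
    using divides_cong_l[OF assoc _ g_closed] divides_cong_l[OF associated_sym[OF assoc] _ cl(1)] by blast
  then show ?thesis using pp_divides_iff[OF z subset_refl] by simp
qed

text \<open>The multiplier \<open>c\<close> permits different representatives with the same
  valuation at \<open>i\<close>.\<close>

lemma pow_divides_pp_mult_iff:
  assumes i: "i \<in> T" and c: "c \<in> carrier R" "\<not> p i divides c"
  shows "p i [^] j divides c \<otimes> pp w T \<longleftrightarrow> j \<le> w i"
proof -
  have cl: "pp w (T - {i}) \<in> carrier R" "p i [^] w i \<in> carrier R"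
    using pp_closed p_closed[OF i] by auto
  have "pp w T = p i [^] w i \<otimes> pp w (T - {i})"
    using pp_insert[of i "T - {i}" w] i by (simp add: insert_absorb)
  then have eq: "pp w T = pp w (T - {i}) \<otimes> p i [^] w i"
    using m_comm[OF cl] by simp
  have "p i [^] j divides c \<otimes> pp w T \<longleftrightarrow> p i [^] j divides pp w T"
    by (rule pow_divides_mult_coprime_iff[OF p_closed[OF i] p_prime[OF i] c(1) _ c(2)])
      (rule pp_closed[OF subset_refl])
  also have "\<dots> \<longleftrightarrow> p i [^] j divides p i [^] w i"
    unfolding eq
    by (rule pow_divides_mult_coprime_iff[OF p_closed[OF i] p_prime[OF i] cl])
      (rule not_divides_pp[OF i], auto)
  finally show ?thesis
    using pow_divides_pow_iff[OF p_closed[OF i] p_prime[OF i]] by simp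
qed

lemma not_prime_divides_one: "i \<in> T \<Longrightarrow> \<not> p i divides \<one>"
  using Unit_eq_dividesone ring_primeD(2) p_closed p_prime by blast

lemma pow_divides_pp_iff: "i \<in> T \<Longrightarrow> p i [^] j divides pp w T \<longleftrightarrow> j \<le> w i"
  using pow_divides_pp_mult_iff[of i \<one> j w] not_prime_divides_one pp_closed by simp

text \<open>Two representatives differ by a multiple of \<open>g\<close>, hence of
  \<open>p i [^] m i\<close>, so the powers of \<open>p i\<close> up to the cap divide both or
  neither.\<close>

lemma val_coset:
  assumes x: "x \<in> carrier R" and i: "i \<in> T"
  shows "val (PIdl g +> x) i = capped_val (p i) (m i) x"
proof -
  have self: "x \<in> PIdl g +> x"
  proof -
    interpret I: ideal "PIdl g" R by (rule cgenideal_ideal[OF g_closed])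
    show ?thesis by (rule I.a_rcos_self[OF x])
  qed
  define y where "y = (SOME y. y \<in> PIdl g +> x)"
  have "y \<in> PIdl g +> x"
    unfolding y_def by (rule someI) (rule self)
  then obtain h where h: "h \<in> PIdl g" "y = h \<oplus> x"
    unfolding a_r_coset_def' by blast
  have hc: "h \<in> carrier R" and "g divides h"
    using h(1) mem_cgenideal_iff[OF g_closed] by simp_all
  have y: "y \<in> carrier R"
    using hc x by (simp add: h(2))
  have eq: "y \<ominus> x = h"
    unfolding h(2) minus_eq using hc x by (simp add: a_assoc r_neg)
  have "p i [^] m i divides (y \<ominus> x)"
    unfolding eq using \<open>g divides h\<close> g_divides_iff[OF hc] i by blast
  then have "p i [^] j divides (y \<ominus> x)" if "j \<le> m i" for j
    by (rule pow_divides_antimono[OF p_closed[OF i] minus_closed[OF y x] _ that])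
  then have "p i [^] j divides y \<longleftrightarrow> p i [^] j divides x" if "j \<le> m i" for j
    using divides_minus_cancel[OF nat_pow_closed[OF p_closed[OF i]] y x] that by blast
  then have "{j. j \<le> m i \<and> p i [^] j divides y} = {j. j \<le> m i \<and> p i [^] j divides x}"
    by auto
  then show ?thesis unfolding val_def capped_val_def y_def[symmetric] by simp
qed

lemma val_coset_eqI:
  assumes x: "x \<in> carrier R" and i: "i \<in> T" and w: "w \<le> m i"
    and iff: "\<And>j. j \<le> m i \<Longrightarrow> p i [^] j divides x \<longleftrightarrow> j \<le> w"
  shows "val (PIdl g +> x) i = w"
  unfolding val_coset[OF x i]
  using le_capped_val_iff[OF p_closed[OF i] x] capped_val_mem(1)[OF p_closed[OF i] x] iff w
  by (meson le_antisym order_refl)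

text \<open>If \<open>m i - a\<close> is at least \<open>2\<close>, then \<open>1 - p i\<close>
  works, as its difference from \<open>1\<close> is just \<open>p i\<close>. Otherwise the exponent
  is \<open>1\<close>, and a residue class other than those of \<open>0\<close> and \<open>1\<close>
  is taken.\<close>

lemma exists_distinct_multiplier:
  assumes i: "i \<in> T" and a: "a < m i" and c: "Suc a < m i \<or> \<not> two i"
  shows "\<exists>c\<in>carrier R. \<not> p i divides c \<and> \<not> p i [^] (m i - a) divides (\<one> \<ominus> c)"
proof (cases "Suc a < m i")
  case True
  note cl = p_closed[OF i]
  have eq: "\<one> \<ominus> (\<one> \<ominus> p i) = p i" using cl by algebra
  have "\<not> p i divides (\<one> \<ominus> p i)"
    using divides_minus_cancel[of "p i" \<one> "p i"] not_prime_divides_one[OF i] cl by auto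
  moreover have "\<not> p i [^] (m i - a) divides p i"
    using pow_divides_pow_iff[OF cl p_prime[OF i], of "m i - a" 1] True cl by simp
  ultimately show ?thesis using cl eq by (intro bexI[of _ "\<one> \<ominus> p i"]) auto
next
  case False
  then have "m i - a = 1" "\<not> two i" using a c by auto
  then show ?thesis
    using card_residue_ring_eq_2_iff[OF p_closed[OF i] p_prime[OF i]] p_closed[OF i]
    by (auto simp: two_def)
qed

text \<open>The witnesses are the cosets of \<open>pp w T\<close> and of \<open>c\<close> times it.
  The difference is \<open>pp w T\<close> times \<open>1 - c\<close>; since \<open>pp w T\<close>
  contributes only \<open>a\<close> at \<open>p i\<close>, divisibility by \<open>g\<close> would
  force \<open>p i [^] (m i - a)\<close> to divide \<open>1 - c\<close>.\<close>

lemma ex_two_cosets: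
  assumes i: "i \<in> T" and a: "a < m i" and two: "Suc a < m i \<or> \<not> two i"
  shows "\<exists>x\<in>carrier Q. \<exists>y\<in>carrier Q. x \<noteq> y \<and>
    (\<forall>j\<in>T. val x j = (if j = i then a else m j) \<and> val y j = (if j = i then a else m j))"
proof -
  define w where "w j = (if j = i then a else m j)" for j
  obtain c where c: "c \<in> carrier R" "\<not> p i divides c" "\<not> p i [^] (m i - a) divides (\<one> \<ominus> c)"
    using exists_distinct_multiplier[OF assms] by blast
  note P = pp_closed[OF subset_refl, of w]
  have cP: "c \<otimes> pp w T \<in> carrier R" using P c by simp
  have w: "w j \<le> m j" for j using a by (simp add: w_def)
  have v1: "val (PIdl g +> pp w T) j = w j" if "j \<in> T" for j
    using pow_divides_pp_iff w that by (intro val_coset_eqI[OF P]) auto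
  have v2: "val (PIdl g +> (c \<otimes> pp w T)) j = w j" if j: "j \<in> T" for j
  proof (cases "j = i")
    case True
    then show ?thesis
      using pow_divides_pp_mult_iff[OF i c(1,2)] w i by (intro val_coset_eqI[OF cP]) auto
  next
    case False
    \<comment> \<open>The factor \<open>c\<close> may be divisible by \<open>p j\<close>, but the
      valuation at \<open>j\<close> has already reached its cap.\<close>
    have "p j [^] l divides c \<otimes> pp w T" if "l \<le> m j" for l
      using pow_divides_pp_iff[OF j, of l w] that False c P p_closed[OF j]
      by (intro divides_prod_l) (auto simp: w_def)
    then show ?thesis
      using j False by (intro val_coset_eqI[OF cP]) (auto simp: w_def)
  qed
  have "\<not> g divides (pp w T \<ominus> c \<otimes> pp w T)"
  proof
    assume "g divides (pp w T \<ominus> c \<otimes> pp w T)"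
    moreover have "pp w T \<ominus> c \<otimes> pp w T = pp w T \<otimes> (\<one> \<ominus> c)"
      using P c by algebra
    ultimately have "p i [^] m i divides pp w T \<otimes> (\<one> \<ominus> c)"
      using g_divides_iff i P c by auto
    then obtain s t where st: "s + t = m i" "p i [^] s divides pp w T" "p i [^] t divides (\<one> \<ominus> c)"
      using pow_divides_mult_iff[OF p_closed[OF i] p_prime[OF i] P, of "\<one> \<ominus> c" "m i"] c by auto
    then have "s \<le> a" using pow_divides_pp_iff[OF i] by (simp add: w_def)
    then have "m i - a \<le> t" using st(1) by simp
    then show False
      using pow_divides_antimono[OF p_closed[OF i] _ st(3)] c by blast
  qed
  then have "PIdl g +> pp w T \<noteq> PIdl g +> (c \<otimes> pp w T)"
    using coset_eq_iff[OF g_closed P cP] by blast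
  moreover have "PIdl g +> pp w T \<in> carrier Q" "PIdl g +> (c \<otimes> pp w T) \<in> carrier Q"
    unfolding carrier_FactRing_cgenideal using P cP by auto
  ultimately show ?thesis using v1 v2 unfolding w_def by blast
qed

text \<open>Representatives prime to \<open>p i\<close> are both congruent to \<open>1\<close>
  modulo \<open>p i\<close>, because the residue ring has two elements; at the other primes both are
  divisible by the full power. Hence \<open>g\<close> divides their difference.\<close>

lemma coset_unique:
  assumes i: "i \<in> T" "m i = 1" "two i" and X: "X \<in> carrier Q" and Y: "Y \<in> carrier Q"
    and vX: "\<forall>j\<in>T. val X j = (if j = i then 0 else m j)"
    and vY: "\<forall>j\<in>T. val Y j = (if j = i then 0 else m j)"
  shows "X = Y"
proof -
  obtain x y where x: "x \<in> carrier R" "X = PIdl g +> x" and y: "y \<in> carrier R" "Y = PIdl g +> y"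
    using X Y unfolding carrier_FactRing_cgenideal by blast
  have dvd: "p j [^] m j divides z" if "j \<in> T" "j \<noteq> i" "z \<in> carrier R"
    "\<forall>j\<in>T. val (PIdl g +> z) j = (if j = i then 0 else m j)" for j z
    using that val_coset[OF that(3,1)] le_capped_val_iff[OF p_closed[OF that(1)] that(3), of "m j" "m j"]
    by simp
  have i_dvd: "p i divides (\<one> \<ominus> z)" if "z \<in> carrier R"
    "\<forall>j\<in>T. val (PIdl g +> z) j = (if j = i then 0 else m j)" for z
  proof -
    have "\<not> p i divides z"
      using that val_coset[OF that(1) i(1)] le_capped_val_iff[OF p_closed[OF i(1)] that(1), of 1 1] i
        p_closed[OF i(1)] by simp
    then show ?thesis
      using card_residue_ring_eq_2_iff[OF p_closed p_prime] i that by (auto simp: two_def)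
  qed
  have "p j [^] m j divides (x \<ominus> y)" if j: "j \<in> T" for j
  proof (cases "j = i")
    case True
    have "p i divides ((\<one> \<ominus> y) \<ominus> (\<one> \<ominus> x))"
      using i_dvd x y vX vY p_closed[OF i(1)]
      by (intro divides_minus[of "p i" "\<one> \<ominus> y" "\<one> \<ominus> x"]) auto
    moreover have "(\<one> \<ominus> y) \<ominus> (\<one> \<ominus> x) = x \<ominus> y" using x y by algebra
    ultimately show ?thesis using True i p_closed[OF i(1)] by simp
  next
    case False
    then show ?thesis
      using dvd[OF j False] x y vX vY p_closed[OF j] by (intro divides_minus) auto
  qed
  then show ?thesis
    using coset_eq_iff[OF g_closed x(1) y(1)] g_divides_iff x y by simp
qed

lemma coset_mult_eq_zero_iff:
  assumes x: "x \<in> carrier R" and y: "y \<in> carrier R"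
  shows "(PIdl g +> x) \<otimes>\<^bsub>Q\<^esub> (PIdl g +> y) = \<zero>\<^bsub>Q\<^esub> \<longleftrightarrow> g divides x \<otimes> y"
proof -
  note I = cgenideal_ideal[OF g_closed]
  have "\<zero>\<^bsub>Q\<^esub> = PIdl g +> \<zero>"
    using a_rcos_zero[OF I additive_subgroup.zero_closed[OF ideal.axioms(1)[OF I]]]
    by (simp add: FactRing_def)
  moreover have "(PIdl g +> x) \<otimes>\<^bsub>Q\<^esub> (PIdl g +> y) = PIdl g +> (x \<otimes> y)"
    using ideal.rcoset_mult_add[OF I x y] by (simp add: FactRing_def)
  ultimately show ?thesis
    using coset_eq_iff[OF g_closed m_closed[OF x y] zero_closed] x y by (simp add: minus_eq)
qed

section \<open>The quotient as a ring with capped valuations\<close>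

lemma carrier_cosetE:
  assumes "X \<in> carrier Q"
  obtains x where "x \<in> carrier R" "X = PIdl g +> x"
  using assms unfolding carrier_FactRing_cgenideal by blast

lemma val_le_m:
  assumes X: "X \<in> carrier Q" and i: "i \<in> T"
  shows "val X i \<le> m i"
proof -
  obtain x where x: "x \<in> carrier R" "X = PIdl g +> x"
    using X by (rule carrier_cosetE)
  show ?thesis
    unfolding x(2) val_coset[OF x(1) i] by (rule capped_val_mem(1)[OF p_closed[OF i] x(1)])
qed

lemma mult_eq_zero_iff_val:
  assumes X: "X \<in> carrier Q" and Y: "Y \<in> carrier Q"
  shows "X \<otimes>\<^bsub>Q\<^esub> Y = \<zero>\<^bsub>Q\<^esub> \<longleftrightarrow> (\<forall>i\<in>T. m i \<le> val X i + val Y i)"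
proof -
  obtain x where x: "x \<in> carrier R" "X = PIdl g +> x"
    using X by (rule carrier_cosetE)
  obtain y where y: "y \<in> carrier R" "Y = PIdl g +> y"
    using Y by (rule carrier_cosetE)
  have "g divides x \<otimes> y \<longleftrightarrow> (\<forall>i\<in>T. p i [^] m i divides x \<otimes> y)"
    by (rule g_divides_iff[OF m_closed[OF x(1) y(1)]])
  also have "\<dots> \<longleftrightarrow> (\<forall>i\<in>T. m i \<le> val X i + val Y i)"
  proof (rule ball_cong[OF refl])
    fix i
    assume i: "i \<in> T"
    show "p i [^] m i divides x \<otimes> y \<longleftrightarrow> m i \<le> val X i + val Y i"
      unfolding x(2) y(2) val_coset[OF x(1) i] val_coset[OF y(1) i]
      by (rule pow_divides_mult_capped_val[OF p_closed[OF i] p_prime[OF i] x(1) y(1)])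
  qed
  finally show ?thesis
    unfolding x(2) y(2) coset_mult_eq_zero_iff[OF x(1) y(1)] .
qed

lemma ex_val_coset:
  assumes w: "\<And>i. i \<in> T \<Longrightarrow> w i \<le> m i"
  shows "\<exists>X\<in>carrier Q. \<forall>i\<in>T. val X i = w i"
proof (intro bexI ballI)
  note P = pp_closed[OF subset_refl, of w]
  show "PIdl g +> pp w T \<in> carrier Q"
    unfolding carrier_FactRing_cgenideal using P by blast
  show "val (PIdl g +> pp w T) i = w i" if "i \<in> T" for i
    using that by (intro val_coset_eqI[OF P] w pow_divides_pp_iff)
qed

lemma capped_valuation_ring:
  assumes "finite (carrier Q)"
  shows "capped_valuation_ring Q T m val two"
proof (rule capped_valuation_ring.intro)
  show "cring Q"
    by (rule ideal.quotient_is_cring[OF cgenideal_ideal[OF g_closed] is_cring])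
  show "capped_valuation_ring_axioms Q T m val two"
    by (rule capped_valuation_ring_axioms.intro)
      (fact assms finite_T card_T m_pos val_le_m mult_eq_zero_iff_val ex_val_coset ex_two_cosets
        coset_unique)+
qed

end

section \<open>The five cases of the boxicity formula\<close>

theorem theorem79:
  fixes R :: "('a, 'b) ring_scheme"
    and I :: "'a set"
    and Q :: "'a set ring"
    and g u :: 'a
    and n :: nat
    and p :: "nat \<Rightarrow> 'a"
    and m :: "nat \<Rightarrow> nat"
  assumes "principal_domain R"
    and "g \<in> carrier R"
    and "I = PIdl\<^bsub>R\<^esub> g"
    and "I \<noteq> carrier R"
    and "\<not> primeideal I R"
    and "Q = R Quot I"
    and "finite (carrier Q)"
    and "u \<in> Units R"
    and "\<forall>i \<in> {1..n}. p i \<in> carrier R \<and> ring_prime\<^bsub>R\<^esub> (p i)"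
    and "\<forall>i \<in> {1..n}. \<forall>j \<in> {1..n}. i \<noteq> j \<longrightarrow> \<not> p i \<sim>\<^bsub>R\<^esub> p j"
    and "\<forall>i \<in> {1..n}. m i \<ge> 1"
    and "g = u \<otimes>\<^bsub>R\<^esub> (\<Otimes>\<^bsub>R\<^esub>i \<in> {1..n}. p i [^]\<^bsub>R\<^esub> m i)"
    and "n \<ge> 2"
  shows
    "((\<exists>i \<in> {1..n}. m i \<ge> 3) \<longrightarrow>
        boxicity (zero_divisor_graph Q) = n) \<and>
     ((\<forall>i \<in> {1..n}. m i = 2 \<or> card (carrier (R Quot (PIdl\<^bsub>R\<^esub> (p i)))) \<ge> 3) \<longrightarrow>
        boxicity (zero_divisor_graph Q) = n) \<and>
     (n \<ge> 3 \<and> (\<forall>i \<in> {1..n}. m i \<in> {1, 2}) \<and>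
        (\<exists>i \<in> {1..n}. m i = 1 \<and> card (carrier (R Quot (PIdl\<^bsub>R\<^esub> (p i)))) = 2) \<longrightarrow>
        boxicity (zero_divisor_graph Q) = n - 1) \<and>
     (n = 2 \<and> m 1 \<in> {1, 2} \<and> m 2 \<in> {1, 2} \<and>
        (\<exists>!i. i \<in> {1, 2} \<and> m i = 1 \<and> card (carrier (R Quot (PIdl\<^bsub>R\<^esub> (p i)))) = 2) \<longrightarrow>
        boxicity (zero_divisor_graph Q) = 1) \<and>
     (n = 2 \<and> m 1 = 1 \<and> m 2 = 1 \<and>
        card (carrier (R Quot (PIdl\<^bsub>R\<^esub> (p 1)))) = 2 \<and>
        card (carrier (R Quot (PIdl\<^bsub>R\<^esub> (p 2)))) = 2 \<longrightarrow>
        boxicity (zero_divisor_graph Q) = 0)"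
proof -
  have card: "card {1..n} = n" by simp
  interpret principal_domain R by fact
  interpret P: prime_power_quotient R "{1..n}" p m u
  proof unfold_locales
    show "2 \<le> card {1..n}" using \<open>n \<ge> 2\<close> unfolding card .
    show "p i \<in> carrier R" "ring_prime\<^bsub>R\<^esub> (p i)" if "i \<in> {1..n}" for i
      using assms(9) that by blast+
    show "\<not> p i \<sim>\<^bsub>R\<^esub> p j" if "i \<in> {1..n}" "j \<in> {1..n}" "i \<noteq> j" for i j
      using assms(10) that by blast
    show "m i \<ge> 1" if "i \<in> {1..n}" for i
      using assms(11) that by blast
    show "u \<in> Units R" by fact
  qed (rule finite_atLeastAtMost)
  have Q: "Q = R Quot (PIdl\<^bsub>R\<^esub> P.g)"
    unfolding assms(3,6,12) P.g_def P.pp_def ..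
  interpret V: capped_valuation_ring Q "{1..n}" m P.val P.two
    using assms(7) unfolding Q by (rule P.capped_valuation_ring)
  have le: "boxicity (zero_divisor_graph Q) \<le> n"
    using V.boxicity_le_card_T unfolding card .
  \<comment> \<open>Used with all indices in the second case and with a single index in the
    fourth.\<close>
  have ge: "card S \<le> boxicity (zero_divisor_graph Q)"
    if "S \<subseteq> {i \<in> {1..n}. m i \<ge> 2 \<or> \<not> P.two i}" for S
  proof -
    have "card S \<le> card {i \<in> {1..n}. m i \<ge> 2 \<or> \<not> P.two i}"
      using that by (rule card_mono[rotated]) (rule finite_subset[OF _ finite_atLeastAtMost], blast)
    then show ?thesis using V.card_le_boxicity by (rule order_trans)
  qed
  show ?thesis
    unfolding P.two_def[symmetric]
  proof (intro conjI impI)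
    assume "\<exists>i\<in>{1..n}. m i \<ge> 3"
    then obtain i where "i \<in> {1..n}" "m i \<ge> 3" by blast
    then have "n \<le> boxicity (zero_divisor_graph Q)"
      using V.card_T_le_boxicity unfolding card by blast
    with le show "boxicity (zero_divisor_graph Q) = n" by (rule le_antisym)
  next
    assume *: "\<forall>i\<in>{1..n}. m i = 2 \<or> 3 \<le> card (carrier (R Quot (PIdl\<^bsub>R\<^esub> (p i))))"
    have "m i \<ge> 2 \<or> \<not> P.two i" if "i \<in> {1..n}" for i
      using bspec[OF * that] unfolding P.two_def by linarith
    then have "card {1..n} \<le> boxicity (zero_divisor_graph Q)"
      by (intro ge) blast
    with le show "boxicity (zero_divisor_graph Q) = n"
      unfolding card by (rule le_antisym)
  next
    assume *: "n \<ge> 3 \<and> (\<forall>i\<in>{1..n}. m i \<in> {1, 2}) \<and> (\<exists>i\<in>{1..n}. m i = 1 \<and> P.two i)"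
    then obtain k where k: "k \<in> {1..n}" "m k = 1" "P.two k" by blast
    have "boxicity (zero_divisor_graph Q) \<le> n - 1"
      using V.boxicity_le_card_T_minus_1[OF k] * unfolding card by blast
    moreover have "n - 1 \<le> boxicity (zero_divisor_graph Q)"
      using V.card_T_minus_1_le_boxicity * unfolding card by blast
    ultimately show "boxicity (zero_divisor_graph Q) = n - 1" by (rule le_antisym)
  next
    assume *: "n = 2 \<and> m 1 \<in> {1, 2} \<and> m 2 \<in> {1, 2} \<and> (\<exists>!i. i \<in> {1, 2} \<and> m i = 1 \<and> P.two i)"
    then have "n = 2" by (rule conjunct1)
    then have n: "{1..n} = {1, 2}" and n1: "n - 1 = 1" by auto
    obtain k where k: "k \<in> {1..n}" "m k = 1" "P.two k"
      and uniq: "\<And>i. i \<in> {1, 2} \<Longrightarrow> m i = 1 \<Longrightarrow> P.two i \<Longrightarrow> i = k"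
    proof -
      obtain k where k: "k \<in> {1, 2}" "m k = 1" "P.two k"
        and uniq: "\<forall>i. i \<in> {1, 2} \<and> m i = 1 \<and> P.two i \<longrightarrow> i = k"
        using conjunct2[OF conjunct2[OF conjunct2[OF *]]] by (elim ex1E conjE)
      show ?thesis
        by (rule that[of k]) (use k uniq in \<open>unfold n, blast+\<close>)
    qed
    have "m i \<in> {1, 2}" if "i \<in> {1..n}" for i
      using that * unfolding n by blast
    then have "boxicity (zero_divisor_graph Q) \<le> 1"
      using V.boxicity_le_card_T_minus_1[OF k] unfolding card n1 by blast
    moreover have "1 \<le> boxicity (zero_divisor_graph Q)"
    proof -
      \<comment> \<open>The index other than \<open>k\<close> violates \<open>m l = 1\<close> or
        \<open>P.two l\<close>, so it contributes one non-adjacent pair and the lower bound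
        \<open>1\<close>.\<close>
      obtain l :: nat where l: "l \<in> {1, 2}" "l \<noteq> k"
        by (cases "k = 1") auto
      have "m l \<in> {1, 2}" using l(1) * by blast
      then have "m l \<ge> 2 \<or> \<not> P.two l"
        using uniq[OF l(1)] l(2) by fastforce
      then have "{l} \<subseteq> {i \<in> {1..n}. m i \<ge> 2 \<or> \<not> P.two i}"
        using l(1) unfolding n by blast
      then have "card {l} \<le> boxicity (zero_divisor_graph Q)" by (rule ge)
      then show ?thesis by simp
    qed
    ultimately show "boxicity (zero_divisor_graph Q) = 1" by (rule le_antisym)
  next
    assume *: "n = 2 \<and> m 1 = 1 \<and> m 2 = 1 \<and> P.two 1 \<and> P.two 2"
    then have "n = 2" by (rule conjunct1)
    then have n: "{1..n} = {1, 2}" by auto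
    show "boxicity (zero_divisor_graph Q) = 0"
    proof (rule V.boxicity_eq_0[OF n])
      show "(1 :: nat) \<noteq> 2" by simp
    qed (use * in blast)+
  qed
qed

end
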